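(* Let $(A,B)$ be a diffuse Pythagorean pair acting on a complex Hilbert space $\mathfrak H$, and let $\sigma=\sigma_{A,B}:F\to\mathcal U(\mathscr H)$ be the associated Pythagorean representation of Thompson's group $F$. Then $\sigma$ is Ind-mixing; that is, for every non-trivial subgroup $K\subset F$ and every non-zero finite-dimensional unitary representation $\theta:K\to\mathcal U(\mathfrak K)$, the induced representation $\mathrm{Ind}_K^F\theta$ is not contained in $\sigma$ (it is not unitarily equivalent to a subrepresentation of $\sigma$).
   Context: All Hilbert spaces are complex, all groups are discrete, all representations are unitary. Trees and forests. A tree is a finite non-empty rooted binary tree in which each vertex has either no children (a leaf) or exactly two children (left and right); it is viewed as a rooted subtree of the infinite rooted binary tree, and its leaves are ordered from left to right. $\mathrm{Leaf}(t)$ is the set of leaves of $t$. A forest is a finite ordered list of trees; its roots and leaves are ordered from left to right. If a forest $f$ has as many roots as $t$ has leaves, $f\circ t$ is the tree obtained by attaching the $j$th tree of $f$ at the $j$th leaf of $t$. Composition of forests is defined similarly. Write $t\preceq s$ if $t$ is a rooted subtree of $s$, equivalently $s=f\circ t$ for a (unique) forest $f$. The trivial tree (one leaf) is denoted $e$. Thompson's group $F$. $F$ is the set of classes $[t,s]$ of pairs of trees with the same number of leaves, for the equivalence relation generated by $(f\circ t,f\circ s)\sim(t,s)$, with product $[t,s][t',s']=[f\circ t,f'\circ s']$ for any forests $f,f'$ with $f\circ s=f'\circ t'$; then $[t,s]^{-1}=[s,t]$. Pythagorean pair. A pair of bounded operators $(A,B)$ on a Hilbert space $\mathfrak H$ with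 $A^*A+B^*B=\mathrm{id}_{\mathfrak H}$. It is diffuse if for every sequence $(x_k)_{k\ge1}$ with $x_k\in\{A,B\}$ and every $\xi\in\mathfrak H$, one has $\lim_{n\to\infty}x_nx_{n-1}\cdots x_1\xi=0$ in norm. Pythagorean representation. For a tree $t$ let $\mathfrak H_t=\ell^2(\mathrm{Leaf}(t),\mathfrak H)\cong\mathfrak H^{\oplus n}$, where $n=|\mathrm{Leaf}(t)|$; elements are written $(t,\xi)$, decorations of the leaves of $t$ by vectors of $\mathfrak H$. For the forest $f_{k,n}$ with $n$ roots, all of whose trees are trivial except the $k$th which has two leaves, set $\Phi(f_{k,n})(\xi_1,\dots,\xi_n)=(\xi_1,\dots,\xi_{k-1},A\xi_k,B\xi_k,\xi_{k+1},\dots,\xi_n)$, and extend $\Phi$ to all forests by $\Phi(f\circ g)=\Phi(f)\Phi(g)$ (this is well-defined, and each $\Phi(f)$ is an isometry). The maps $\mathfrak H_t\to\mathfrak H_{f\circ t}$, $(t,\xi)\mapsto(f\circ t,\Phi(f)\xi)$, form a directed system of isometries indexed by the directed poset of trees; $\mathscr K$ is its direct limit (a pre-Hilbert space), with elements written $[t,\xi]$, and $\mathscr H$ is the completion of $\mathscr K$. The Pythagorean representation $\sigma=\sigma_{A,B}$ of $F$ on $\mathscr H$ is the unitary representation determined by $\sigma([t,s])[s,\xi]=[t,\xi]$ (given $g\in F$ and $z\in\mathscr K$ one can always choose representatives $g=[t,s]$, $z=[s,\xi]$ with a common tree $s$). *)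

theory Defs
  imports "HOL-Analysis.Infinite_Sum" "HOL-Algebra.Left_Coset"
begin

section \<open>Complex Hilbert spaces\<close>

text \<open>
  The direct limit and its completion depend on the operators \<open>A\<close> and \<open>B\<close>, so they cannot be types;
  all Hilbert spaces are therefore given by a carrier set together with their operations.
  Inner products are linear in the first argument.
\<close>

record 'a cspace = "'a partial_object" +
  vzero :: 'a
  vadd :: "'a \<Rightarrow> 'a \<Rightarrow> 'a"
  vscale :: "complex \<Rightarrow> 'a \<Rightarrow> 'a"
  vinner :: "'a \<Rightarrow> 'a \<Rightarrow> complex"

definition vnorm :: "'a cspace \<Rightarrow> 'a \<Rightarrow> real" where
  "vnorm X x = sqrt (Re (vinner X x x))"

definition vdist :: "'a cspace \<Rightarrow> 'a \<Rightarrow> 'a \<Rightarrow> real" where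
  "vdist X x y = vnorm X (vadd X x (vscale X (-1) y))"

definition vconv :: "'a cspace \<Rightarrow> (nat \<Rightarrow> 'a) \<Rightarrow> 'a \<Rightarrow> bool" where
  "vconv X s x \<longleftrightarrow> (\<lambda>n. vdist X (s n) x) \<longlonglongrightarrow> 0"

definition vcauchy :: "'a cspace \<Rightarrow> (nat \<Rightarrow> 'a) \<Rightarrow> bool" where
  "vcauchy X s \<longleftrightarrow> (\<forall>n. s n \<in> carrier X) \<and>
     (\<forall>e>0. \<exists>N. \<forall>m\<ge>N. \<forall>n\<ge>N. vdist X (s m) (s n) < e)"

locale pre_hilbert_space =
  fixes X :: "'a cspace"
  assumes zero_closed: "vzero X \<in> carrier X"
    and add_closed: "\<lbrakk>x \<in> carrier X; y \<in> carrier X\<rbrakk> \<Longrightarrow> vadd X x y \<in> carrier X"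
    and scale_closed: "x \<in> carrier X \<Longrightarrow> vscale X c x \<in> carrier X"
    and add_assoc: "\<lbrakk>x \<in> carrier X; y \<in> carrier X; z \<in> carrier X\<rbrakk>
      \<Longrightarrow> vadd X (vadd X x y) z = vadd X x (vadd X y z)"
    and add_commute: "\<lbrakk>x \<in> carrier X; y \<in> carrier X\<rbrakk> \<Longrightarrow> vadd X x y = vadd X y x"
    and add_zero: "x \<in> carrier X \<Longrightarrow> vadd X x (vzero X) = x"
    and add_inverse: "x \<in> carrier X \<Longrightarrow> \<exists>y\<in>carrier X. vadd X x y = vzero X"
    and scale_add_right: "\<lbrakk>x \<in> carrier X; y \<in> carrier X\<rbrakk>
      \<Longrightarrow> vscale X c (vadd X x y) = vadd X (vscale X c x) (vscale X c y)"
    and scale_add_left: "x \<in> carrier X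
      \<Longrightarrow> vscale X (c + d) x = vadd X (vscale X c x) (vscale X d x)"
    and scale_scale: "x \<in> carrier X \<Longrightarrow> vscale X c (vscale X d x) = vscale X (c * d) x"
    and scale_one: "x \<in> carrier X \<Longrightarrow> vscale X 1 x = x"
    and inner_add_left: "\<lbrakk>x \<in> carrier X; y \<in> carrier X; z \<in> carrier X\<rbrakk>
      \<Longrightarrow> vinner X (vadd X x y) z = vinner X x z + vinner X y z"
    and inner_scale_left: "\<lbrakk>x \<in> carrier X; y \<in> carrier X\<rbrakk>
      \<Longrightarrow> vinner X (vscale X c x) y = c * vinner X x y"
    and inner_commute: "\<lbrakk>x \<in> carrier X; y \<in> carrier X\<rbrakk> \<Longrightarrow> vinner X x y = cnj (vinner X y x)"
    and inner_pos: "\<lbrakk>x \<in> carrier X; x \<noteq> vzero X\<rbrakk> \<Longrightarrow> Re (vinner X x x) > 0"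

locale hilbert_space = pre_hilbert_space +
  assumes complete: "vcauchy X s \<Longrightarrow> \<exists>x\<in>carrier X. vconv X s x"

definition csubspace :: "'a cspace \<Rightarrow> 'a set \<Rightarrow> bool" where
  "csubspace X M \<longleftrightarrow> M \<subseteq> carrier X \<and> vzero X \<in> M \<and>
     (\<forall>x\<in>M. \<forall>y\<in>M. vadd X x y \<in> M) \<and> (\<forall>c. \<forall>x\<in>M. vscale X c x \<in> M)"

definition closed_csubspace :: "'a cspace \<Rightarrow> 'a set \<Rightarrow> bool" where
  "closed_csubspace X M \<longleftrightarrow> csubspace X M \<and>
     (\<forall>s x. (\<forall>n. s n \<in> M) \<longrightarrow> x \<in> carrier X \<longrightarrow> vconv X s x \<longrightarrow> x \<in> M)"

definition cspan :: "'a cspace \<Rightarrow> 'a set \<Rightarrow> 'a set" where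
  "cspan X S = \<Inter>{M. csubspace X M \<and> S \<subseteq> M}"

definition finite_dimensional :: "'a cspace \<Rightarrow> bool" where
  "finite_dimensional X \<longleftrightarrow> (\<exists>S. finite S \<and> S \<subseteq> carrier X \<and> cspan X S = carrier X)"

definition linear_map :: "'a cspace \<Rightarrow> 'b cspace \<Rightarrow> ('a \<Rightarrow> 'b) \<Rightarrow> bool" where
  "linear_map X Y T \<longleftrightarrow> T \<in> carrier X \<rightarrow> carrier Y \<and>
     (\<forall>x\<in>carrier X. \<forall>y\<in>carrier X. T (vadd X x y) = vadd Y (T x) (T y)) \<and>
     (\<forall>c. \<forall>x\<in>carrier X. T (vscale X c x) = vscale Y c (T x))"

definition bounded_operator :: "'a cspace \<Rightarrow> ('a \<Rightarrow> 'a) \<Rightarrow> bool" where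
  "bounded_operator X T \<longleftrightarrow> linear_map X X T \<and>
     (\<exists>C. \<forall>x\<in>carrier X. vnorm X (T x) \<le> C * vnorm X x)"

definition is_adjoint :: "'a cspace \<Rightarrow> ('a \<Rightarrow> 'a) \<Rightarrow> ('a \<Rightarrow> 'a) \<Rightarrow> bool" where
  "is_adjoint X T T' \<longleftrightarrow> bounded_operator X T' \<and>
     (\<forall>x\<in>carrier X. \<forall>y\<in>carrier X. vinner X (T x) y = vinner X x (T' y))"

definition unitary_map :: "'a cspace \<Rightarrow> 'b cspace \<Rightarrow> ('a \<Rightarrow> 'b) \<Rightarrow> bool" where
  "unitary_map X Y U \<longleftrightarrow> linear_map X Y U \<and> bij_betw U (carrier X) (carrier Y) \<and>
     (\<forall>x\<in>carrier X. \<forall>y\<in>carrier X. vinner Y (U x) (U y) = vinner X x y)"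


section \<open>Hilbert space completion\<close>

text \<open>Points of the completion are Cauchy sequences modulo sequences tending to zero.\<close>

definition cauchy_class :: "'a cspace \<Rightarrow> (nat \<Rightarrow> 'a) \<Rightarrow> (nat \<Rightarrow> 'a) set" where
  "cauchy_class X s = {s'. vcauchy X s' \<and> (\<lambda>n. vdist X (s n) (s' n)) \<longlonglongrightarrow> 0}"

definition completion :: "'a cspace \<Rightarrow> (nat \<Rightarrow> 'a) set cspace" where
  "completion X = \<lparr>
     carrier = {cauchy_class X s |s. vcauchy X s},
     vzero = cauchy_class X (\<lambda>n. vzero X),
     vadd = (\<lambda>p q. THE r. \<exists>s s'. vcauchy X s \<and> vcauchy X s' \<and>
       p = cauchy_class X s \<and> q = cauchy_class X s' \<and>
       r = cauchy_class X (\<lambda>n. vadd X (s n) (s' n))),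
     vscale = (\<lambda>c p. THE r. \<exists>s. vcauchy X s \<and>
       p = cauchy_class X s \<and> r = cauchy_class X (\<lambda>n. vscale X c (s n))),
     vinner = (\<lambda>p q. THE c. \<exists>s s'. vcauchy X s \<and> vcauchy X s' \<and>
       p = cauchy_class X s \<and> q = cauchy_class X s' \<and>
       (\<lambda>n. vinner X (s n) (s' n)) \<longlonglongrightarrow> c)\<rparr>"

text \<open>The continuous extension to the completion of a linear isometry \<open>T\<close> of \<open>X\<close>.\<close>

definition completion_map ::
  "'a cspace \<Rightarrow> ('a \<Rightarrow> 'a) \<Rightarrow> (nat \<Rightarrow> 'a) set \<Rightarrow> (nat \<Rightarrow> 'a) set" where
  "completion_map X T p = (THE r. \<exists>s. vcauchy X s \<and>
     p = cauchy_class X s \<and> r = cauchy_class X (\<lambda>n. T (s n)))"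


section \<open>Unitary representations\<close>

definition unitary_rep :: "'g monoid \<Rightarrow> 'a cspace \<Rightarrow> ('g \<Rightarrow> 'a \<Rightarrow> 'a) \<Rightarrow> bool" where
  "unitary_rep G X \<pi> \<longleftrightarrow> (\<forall>g\<in>carrier G. unitary_map X X (\<pi> g)) \<and>
     (\<forall>g\<in>carrier G. \<forall>h\<in>carrier G. \<forall>x\<in>carrier X. \<pi> (g \<otimes>\<^bsub>G\<^esub> h) x = \<pi> g (\<pi> h x))"

definition unitarily_equivalent ::
  "'g monoid \<Rightarrow> 'a cspace \<Rightarrow> ('g \<Rightarrow> 'a \<Rightarrow> 'a) \<Rightarrow> 'b cspace \<Rightarrow> ('g \<Rightarrow> 'b \<Rightarrow> 'b) \<Rightarrow> bool" where
  "unitarily_equivalent G X \<pi> Y \<rho> \<longleftrightarrow>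
     (\<exists>U. unitary_map X Y U \<and> (\<forall>g\<in>carrier G. \<forall>x\<in>carrier X. U (\<pi> g x) = \<rho> g (U x)))"

definition subrepresentation ::
  "'g monoid \<Rightarrow> 'a cspace \<Rightarrow> ('g \<Rightarrow> 'a \<Rightarrow> 'a) \<Rightarrow> 'a set \<Rightarrow> bool" where
  "subrepresentation G X \<pi> M \<longleftrightarrow>
     closed_csubspace X M \<and> (\<forall>g\<in>carrier G. \<forall>x\<in>M. \<pi> g x \<in> M)"

definition contained_in ::
  "'g monoid \<Rightarrow> 'a cspace \<Rightarrow> ('g \<Rightarrow> 'a \<Rightarrow> 'a) \<Rightarrow> 'b cspace \<Rightarrow> ('g \<Rightarrow> 'b \<Rightarrow> 'b) \<Rightarrow> bool" where
  "contained_in G X \<pi> Y \<rho> \<longleftrightarrow>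
     (\<exists>M. subrepresentation G Y \<rho> M \<and> unitarily_equivalent G X \<pi> (Y\<lparr>carrier := M\<rparr>) \<rho>)"

text \<open>
  The induced representation acts by left translation on the functions
  \<open>\<phi> : G \<rightarrow> X\<close> with \<open>\<phi>(gk) = \<theta>(k)\<inverse> \<phi>(g)\<close> that are square-summable over \<open>G/K\<close>.
  By equivariance the terms of the sums below do not depend on the chosen coset representatives.
\<close>

definition coset_rep :: "'g set \<Rightarrow> 'g" where
  "coset_rep C = (SOME g. g \<in> C)"

definition ind_space ::
  "'g monoid \<Rightarrow> 'g set \<Rightarrow> 'a cspace \<Rightarrow> ('g \<Rightarrow> 'a \<Rightarrow> 'a) \<Rightarrow> ('g \<Rightarrow> 'a) cspace" where
  "ind_space G K X \<theta> = \<lparr>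
     carrier = {\<phi> \<in> carrier G \<rightarrow>\<^sub>E carrier X.
       (\<forall>g\<in>carrier G. \<forall>k\<in>K. \<phi> (g \<otimes>\<^bsub>G\<^esub> k) = \<theta> (inv\<^bsub>G\<^esub> k) (\<phi> g)) \<and>
       (\<lambda>C. (vnorm X (\<phi> (coset_rep C)))\<^sup>2) summable_on (lcosets\<^bsub>G\<^esub> K)},
     vzero = (\<lambda>g\<in>carrier G. vzero X),
     vadd = (\<lambda>\<phi> \<psi>. \<lambda>g\<in>carrier G. vadd X (\<phi> g) (\<psi> g)),
     vscale = (\<lambda>c \<phi>. \<lambda>g\<in>carrier G. vscale X c (\<phi> g)),
     vinner = (\<lambda>\<phi> \<psi>. \<Sum>\<^sub>\<infinity>C\<in>lcosets\<^bsub>G\<^esub> K. vinner X (\<phi> (coset_rep C)) (\<psi> (coset_rep C)))\<rparr>"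

definition ind_rep :: "'g monoid \<Rightarrow> 'g \<Rightarrow> ('g \<Rightarrow> 'a) \<Rightarrow> ('g \<Rightarrow> 'a)" where
  "ind_rep G g \<phi> = (\<lambda>x\<in>carrier G. \<phi> (inv\<^bsub>G\<^esub> g \<otimes>\<^bsub>G\<^esub> x))"


section \<open>Trees, forests and Thompson's group \<open>F\<close>\<close>

datatype tree = Leaf | Node tree tree

type_synonym forest = "tree list"

fun leaves :: "tree \<Rightarrow> nat" where
  "leaves Leaf = 1"
| "leaves (Node l r) = leaves l + leaves r"

text \<open>\<open>graft f t\<close> is \<open>f \<circ> t\<close>; it is meaningful only when \<open>length f = leaves t\<close>.\<close>

fun graft :: "forest \<Rightarrow> tree \<Rightarrow> tree" where
  "graft f Leaf = hd f"
| "graft f (Node l r) = Node (graft (take (leaves l) f) l) (graft (drop (leaves l) f) r)"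

inductive pair_step :: "tree \<times> tree \<Rightarrow> tree \<times> tree \<Rightarrow> bool" where
  "\<lbrakk>leaves t = leaves s; length f = leaves t\<rbrakk> \<Longrightarrow> pair_step (t, s) (graft f t, graft f s)"

definition fclass :: "tree \<Rightarrow> tree \<Rightarrow> (tree \<times> tree) set" where
  "fclass t s = {p. equivclp pair_step (t, s) p}"

definition thompson_F :: "(tree \<times> tree) set monoid" where
  "thompson_F = \<lparr>
     carrier = {fclass t s |t s. leaves t = leaves s},
     mult = (\<lambda>g h. THE k. \<exists>t s t' s' f f'.
       leaves t = leaves s \<and> leaves t' = leaves s' \<and> g = fclass t s \<and> h = fclass t' s' \<and>
       length f = leaves s \<and> length f' = leaves t' \<and> graft f s = graft f' t' \<and>
       k = fclass (graft f t) (graft f' s')),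
     one = fclass Leaf Leaf\<rparr>"


section \<open>Pythagorean pairs and representations\<close>

definition pythagorean_pair :: "'h cspace \<Rightarrow> ('h \<Rightarrow> 'h) \<Rightarrow> ('h \<Rightarrow> 'h) \<Rightarrow> bool" where
  "pythagorean_pair H A B \<longleftrightarrow> bounded_operator H A \<and> bounded_operator H B \<and>
     (\<exists>A' B'. is_adjoint H A A' \<and> is_adjoint H B B' \<and>
        (\<forall>\<xi>\<in>carrier H. vadd H (A' (A \<xi>)) (B' (B \<xi>)) = \<xi>))"

text \<open>\<open>iterate x n\<close> is the product \<open>x\<^sub>n x\<^sub>n\<^sub>-\<^sub>1 \<cdots> x\<^sub>1\<close>.\<close>

primrec iterate :: "(nat \<Rightarrow> 'h \<Rightarrow> 'h) \<Rightarrow> nat \<Rightarrow> 'h \<Rightarrow> 'h" where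
  "iterate x 0 \<xi> = \<xi>"
| "iterate x (Suc n) \<xi> = x (Suc n) (iterate x n \<xi>)"

definition diffuse :: "'h cspace \<Rightarrow> ('h \<Rightarrow> 'h) \<Rightarrow> ('h \<Rightarrow> 'h) \<Rightarrow> bool" where
  "diffuse H A B \<longleftrightarrow> (\<forall>x. (\<forall>k\<ge>1. x k \<in> {A, B}) \<longrightarrow>
     (\<forall>\<xi>\<in>carrier H. vconv H (\<lambda>n. iterate x n \<xi>) (vzero H)))"

text \<open>
  The functor \<open>\<Phi>\<close>, with decorations of the leaves given as lists of vectors. The lemmas
  \<open>Phi_elementary\<close> and \<open>Phi_compose\<close> below are its defining properties.
\<close>

fun Phi_tree :: "('h \<Rightarrow> 'h) \<Rightarrow> ('h \<Rightarrow> 'h) \<Rightarrow> tree \<Rightarrow> 'h \<Rightarrow> 'h list" where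
  "Phi_tree A B Leaf \<xi> = [\<xi>]"
| "Phi_tree A B (Node l r) \<xi> = Phi_tree A B l (A \<xi>) @ Phi_tree A B r (B \<xi>)"

definition Phi :: "('h \<Rightarrow> 'h) \<Rightarrow> ('h \<Rightarrow> 'h) \<Rightarrow> forest \<Rightarrow> 'h list \<Rightarrow> 'h list" where
  "Phi A B f \<xi> = concat (map2 (Phi_tree A B) f \<xi>)"

lemma Phi_Nil [simp]: "Phi A B [] \<xi> = []"
  by (simp add: Phi_def)

lemma Phi_Cons [simp]: "Phi A B (t # f) (x # \<xi>) = Phi_tree A B t x @ Phi A B f \<xi>"
  by (simp add: Phi_def)

lemma Phi_append:
  "length f = length \<xi> \<Longrightarrow> Phi A B (f @ g) (\<xi> @ \<eta>) = Phi A B f \<xi> @ Phi A B g \<eta>"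
  by (simp add: Phi_def)

lemma length_Phi_tree [simp]: "length (Phi_tree A B t x) = leaves t"
  by (induction t arbitrary: x) auto

lemma Phi_replicate_Leaf: "Phi A B (replicate (length \<xi>) Leaf) \<xi> = \<xi>"
  by (induction \<xi>) auto

lemma Phi_elementary:
  "Phi A B (replicate (length \<xi>) Leaf @ [Node Leaf Leaf] @ replicate (length \<eta>) Leaf) (\<xi> @ [x] @ \<eta>)
     = \<xi> @ [A x, B x] @ \<eta>"
  by (simp add: Phi_append Phi_replicate_Leaf)

fun forest_compose :: "forest \<Rightarrow> forest \<Rightarrow> forest" where
  "forest_compose f [] = []"
| "forest_compose f (t # g) = graft (take (leaves t) f) t # forest_compose (drop (leaves t) f) g"

lemma Phi_tree_graft:
  "length f = leaves t \<Longrightarrow> Phi_tree A B (graft f t) x = Phi A B f (Phi_tree A B t x)"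
proof (induction t arbitrary: f x)
  case Leaf
  then show ?case by (cases f) auto
next
  case (Node l r)
  have "Phi A B f (Phi_tree A B (Node l r) x)
      = Phi A B (take (leaves l) f @ drop (leaves l) f) (Phi_tree A B l (A x) @ Phi_tree A B r (B x))"
    by simp
  also have "\<dots> = Phi A B (take (leaves l) f) (Phi_tree A B l (A x))
      @ Phi A B (drop (leaves l) f) (Phi_tree A B r (B x))"
    using Node.prems by (intro Phi_append) auto
  finally show ?case
    using Node by simp
qed

lemma Phi_compose:
  assumes "length \<xi> = length g" "length f = sum_list (map leaves g)"
  shows "Phi A B (forest_compose f g) \<xi> = Phi A B f (Phi A B g \<xi>)"
  using assms
proof (induction g arbitrary: f \<xi>)
  case Nil
  then show ?case by simp
next
  case (Cons t g)
  obtain x \<eta> where \<xi>: "\<xi> = x # \<eta>"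
    using Cons.prems by (cases \<xi>) auto
  have "Phi A B f (Phi A B (t # g) \<xi>)
      = Phi A B (take (leaves t) f @ drop (leaves t) f) (Phi_tree A B t x @ Phi A B g \<eta>)"
    by (simp add: \<xi>)
  also have "\<dots> = Phi A B (take (leaves t) f) (Phi_tree A B t x)
      @ Phi A B (drop (leaves t) f) (Phi A B g \<eta>)"
    using Cons.prems by (intro Phi_append) auto
  finally show ?case
    using Cons \<xi> by (simp add: Phi_tree_graft)
qed

definition decorations :: "'h cspace \<Rightarrow> tree \<Rightarrow> 'h list set" where
  "decorations H t = {\<xi>. length \<xi> = leaves t \<and> set \<xi> \<subseteq> carrier H}"

context
  fixes H :: "'h cspace" and A B :: "'h \<Rightarrow> 'h"
begin

inductive dec_step :: "tree \<times> 'h list \<Rightarrow> tree \<times> 'h list \<Rightarrow> bool" where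
  "\<lbrakk>\<xi> \<in> decorations H t; length f = leaves t\<rbrakk> \<Longrightarrow> dec_step (t, \<xi>) (graft f t, Phi A B f \<xi>)"

definition dec_class :: "tree \<Rightarrow> 'h list \<Rightarrow> (tree \<times> 'h list) set" where
  "dec_class t \<xi> = {p. equivclp dec_step (t, \<xi>) p}"

definition dec_limit :: "(tree \<times> 'h list) set cspace" where
  "dec_limit = \<lparr>
     carrier = {dec_class t \<xi> |t \<xi>. \<xi> \<in> decorations H t},
     vzero = dec_class Leaf [vzero H],
     vadd = (\<lambda>z w. THE v. \<exists>t \<xi> \<eta>. \<xi> \<in> decorations H t \<and> \<eta> \<in> decorations H t \<and>
       z = dec_class t \<xi> \<and> w = dec_class t \<eta> \<and> v = dec_class t (map2 (vadd H) \<xi> \<eta>)),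
     vscale = (\<lambda>c z. THE v. \<exists>t \<xi>. \<xi> \<in> decorations H t \<and>
       z = dec_class t \<xi> \<and> v = dec_class t (map (vscale H c) \<xi>)),
     vinner = (\<lambda>z w. THE c. \<exists>t \<xi> \<eta>. \<xi> \<in> decorations H t \<and> \<eta> \<in> decorations H t \<and>
       z = dec_class t \<xi> \<and> w = dec_class t \<eta> \<and> c = (\<Sum>i<leaves t. vinner H (\<xi> ! i) (\<eta> ! i)))\<rparr>"

definition dec_action ::
  "(tree \<times> tree) set \<Rightarrow> (tree \<times> 'h list) set \<Rightarrow> (tree \<times> 'h list) set" where
  "dec_action g z = (THE w. \<exists>t s \<xi>. leaves t = leaves s \<and> \<xi> \<in> decorations H s \<and>
     g = fclass t s \<and> z = dec_class s \<xi> \<and> w = dec_class t \<xi>)"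

definition pythagorean_space :: "(nat \<Rightarrow> (tree \<times> 'h list) set) set cspace" where
  "pythagorean_space = completion dec_limit"

definition pythagorean_rep ::
  "(tree \<times> tree) set \<Rightarrow> (nat \<Rightarrow> (tree \<times> 'h list) set) set \<Rightarrow> (nat \<Rightarrow> (tree \<times> 'h list) set) set" where
  "pythagorean_rep g = completion_map dec_limit (dec_action g)"

end

end

theory Submission
  imports Defs
begin

text \<open>
  Matrix coefficients of \<open>\<sigma>\<close> are approximated, uniformly over \<open>F\<close>, by those of vectors \<open>[s, \<xi>]\<close>. Let \<open>p\<close> be
  the image in \<open>\<sigma>\<close> of a non-zero vector \<open>x\<close> of \<open>\<theta>\<close>, seen as a function supported on \<open>K\<close>, and approximate
  it by \<open>v = [s, \<xi>]\<close>. By diffuseness and Koenig's lemma \<open>s\<close> can be chosen so fine that every entry of \<open>\<xi>\<close>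
  is small. An element \<open>g\<close> of \<open>F\<close> acting only below one leaf of \<open>s\<close> then moves \<open>v\<close> very little, whereas
  \<open>\<langle>\<sigma>(g) p, p\<rangle> = 0\<close> for \<open>g \<notin> K\<close>; hence \<open>g \<in> K\<close>. So \<open>K\<close> contains all products of such elements, in particular
  those replacing a long right vine by a long left vine below every leaf of \<open>s\<close>. As the vines grow, the
  coefficients of these elements tend to \<open>0\<close>, again by diffuseness, although they act on the
  finite-dimensional space of \<open>\<theta>\<close> by unitaries.
\<close>

section \<open>The calculus of trees and forests\<close>

text \<open>Nothing is known about \<open>K\<close> beforehand, so its elements have to be produced
  by the coefficient test alone: an element whose coefficient at \<open>v\<close> exceeds the
  approximation error must lie in \<open>K\<close>. Only elements that nearly fix \<open>v\<close>
  pass this test, which is why vines are exchanged at one leaf at a time. An exchange at a leaf with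
  entry \<open>y\<close> costs at most twice the squared norm of \<open>y\<close>, whichever two
  trees with equally many leaves are exchanged. Hence the length of the vines stays free and can
  grow after \<open>s\<close> has been fixed. The product of these exchanges belongs to the subgroup
  \<open>K\<close> although it moves \<open>v\<close> far away.

  This product depends on the approximating vector, so the approximation cannot be tuned to a given
  group element; this forces uniformity over \<open>F\<close>. The contradiction is with Parseval's
  identity in the space of \<open>\<theta>\<close>: a unitary preserves the norm of
  \<open>x\<close>, while the finitely many coefficients that determine the norm of its image are
  all at most twice the error.\<close>

lemma leaves_pos [simp]: "0 < leaves t"
  by (induction t) auto

lemma leaves_graft: "length f = leaves t \<Longrightarrow> leaves (graft f t) = sum_list (map leaves f)"
proof (induction t arbitrary: f)
  case Leaf
  then show ?case by (cases f) auto
next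
  case (Node l r)
  have "sum_list (map leaves f) = sum_list (map leaves (take (leaves l) f @ drop (leaves l) f))"
    by simp
  also have "\<dots> = sum_list (map leaves (take (leaves l) f)) + sum_list (map leaves (drop (leaves l) f))"
    by (simp del: append_take_drop_id)
  finally show ?case using Node by simp
qed

lemma graft_replicate_Leaf [simp]: "graft (replicate (leaves t) Leaf) t = t"
  by (induction t) (auto simp: replicate_add)

lemma graft_left_cancel:
  "\<lbrakk>length f = leaves t; length g = leaves t; graft f t = graft g t\<rbrakk> \<Longrightarrow> f = g"
proof (induction t arbitrary: f g)
  case Leaf
  then show ?case by (cases f; cases g) auto
next
  case (Node l r)
  have "take (leaves l) f = take (leaves l) g" "drop (leaves l) f = drop (leaves l) g"
    using Node.prems by (auto intro: Node.IH(1) Node.IH(2))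
  then show ?case by (metis append_take_drop_id)
qed

lemma sum_list_leaves_mono:
  assumes "m < n" "n \<le> length f"
  shows "sum_list (map leaves (take m f)) < sum_list (map leaves (take n f))"
proof -
  have *: "take n f = take m f @ take (n - m) (drop m f)"
    using assms by (metis le_add_diff_inverse less_imp_le take_add)
  have "take (n - m) (drop m f) \<noteq> []"
    using assms by auto
  then obtain x xs where "take (n - m) (drop m f) = x # xs"
    by (cases "take (n - m) (drop m f)") auto
  then show ?thesis
    unfolding * by (simp add: add_pos_nonneg)
qed

text \<open>At a node, the left subtree of the grafted tree determines a partial sum of the leaf
  counts of \<open>f\<close>. Every tree has a leaf, so partial sums increase strictly and both
  trees split \<open>f\<close> at the same position. This is the injectivity that makes pairs of
  trees a \<open>forest_action\<close>.\<close>

lemma graft_right_cancel: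
  "\<lbrakk>length f = leaves s; leaves s = leaves t; graft f s = graft f t\<rbrakk> \<Longrightarrow> s = t"
proof (induction s arbitrary: f t)
  case Leaf
  show ?case
  proof (cases t)
    case (Node l r)
    then show ?thesis using Leaf.prems leaves_pos[of l] leaves_pos[of r] by (simp del: leaves_pos)
  qed auto
next
  case (Node l r)
  show ?case
  proof (cases t)
    case Leaf
    then show ?thesis using Node.prems leaves_pos[of l] leaves_pos[of r] by (simp del: leaves_pos)
  next
    case (Node l' r')
    let ?s = "\<lambda>n. sum_list (map leaves (take n f))"
    have eq: "graft (take (leaves l) f) l = graft (take (leaves l') f) l'"
      "graft (drop (leaves l) f) r = graft (drop (leaves l') f) r'"
      using Node.prems Node by auto
    have len: "leaves l \<le> length f" "leaves l' \<le> length f"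
      using Node.prems Node by auto
    have "?s (leaves l) = ?s (leaves l')"
      using arg_cong[OF eq(1), of leaves] len by (simp add: leaves_graft)
    then have l: "leaves l = leaves l'"
      using sum_list_leaves_mono[of _ _ f] len by (metis nat_neq_iff)
    then have "leaves r = leaves r'"
      using Node.prems Node by auto
    then show ?thesis
      using Node.IH(1)[of "take (leaves l) f" l'] Node.IH(2)[of "drop (leaves l) f" r'] l eq Node.prems
      by (simp add: Node)
  qed
qed

lemma length_forest_compose [simp]: "length (forest_compose f g) = length g"
  by (induction g arbitrary: f) auto

lemma forest_compose_append:
  "forest_compose f (g @ h) =
     forest_compose (take (sum_list (map leaves g)) f) g @ forest_compose (drop (sum_list (map leaves g)) f) h"
  by (induction g arbitrary: f) (auto simp: take_drop add.commute min_def)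

lemma graft_graft:
  "\<lbrakk>length g = leaves t; length f = sum_list (map leaves g)\<rbrakk>
     \<Longrightarrow> graft f (graft g t) = graft (forest_compose f g) t"
proof (induction t arbitrary: f g)
  case Leaf
  then show ?case by (cases g) auto
next
  case (Node l r)
  let ?g = "take (leaves l) g" and ?g' = "drop (leaves l) g"
  let ?n = "sum_list (map leaves ?g)"
  have gs: "sum_list (map leaves g) = ?n + sum_list (map leaves ?g')"
    by (metis append_take_drop_id map_append sum_list_append)
  have n: "leaves (graft ?g l) = ?n"
    using Node.prems by (simp add: leaves_graft)
  have "forest_compose f g = forest_compose (take ?n f) ?g @ forest_compose (drop ?n f) ?g'"
    using forest_compose_append[of f ?g ?g'] by simp
  then show ?case
    using Node gs n by simp
qed

text \<open>The common tree is the union of the two: a leaf of one tree is replaced by what the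
  other has there. This is the directedness of the poset of trees.\<close>

lemma common_refinement:
  "\<exists>f g. length f = leaves t \<and> length g = leaves s \<and> graft f t = graft g s"
proof (induction t arbitrary: s)
  case Leaf
  have "length [s] = leaves Leaf \<and> length (replicate (leaves s) Leaf) = leaves s
      \<and> graft [s] Leaf = graft (replicate (leaves s) Leaf) s"
    by simp
  then show ?case by blast
next
  case (Node l r)
  show ?case
  proof (cases s)
    case Leaf
    have "length (replicate (leaves (Node l r)) Leaf) = leaves (Node l r) \<and> length [Node l r] = leaves s
      \<and> graft (replicate (leaves (Node l r)) Leaf) (Node l r) = graft [Node l r] s"
      using Leaf graft_replicate_Leaf[of "Node l r"] by (simp del: graft_replicate_Leaf)
    then show ?thesis by blast
  next
    case (Node l' r')
    obtain f g where 1: "length f = leaves l" "length g = leaves l'" "graft f l = graft g l'"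
      using Node.IH(1) by blast
    obtain f' g' where 2: "length f' = leaves r" "length g' = leaves r'" "graft f' r = graft g' r'"
      using Node.IH(2) by blast
    have "length (f @ f') = leaves (Node l r) \<and> length (g @ g') = leaves s
      \<and> graft (f @ f') (Node l r) = graft (g @ g') s"
      using 1 2 Node by simp
    then show ?thesis by blast
  qed
qed

text \<open>Both Thompson's group and the space of decorated trees consist of pairs of a tree and a
  datum on its leaves, modulo simultaneous grafting. The datum is a second tree in one case and a
  list of vectors in the other. \<open>D n\<close> holds the data for trees with \<open>n\<close>
  leaves; \<open>act_inj\<close> says that the connecting maps of the directed system are
  injective.\<close>

locale forest_action =
  fixes D :: "nat \<Rightarrow> 'x set" and act :: "forest \<Rightarrow> 'x \<Rightarrow> 'x"
  assumes act_closed: "x \<in> D (length f) \<Longrightarrow> act f x \<in> D (sum_list (map leaves f))"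
    and act_compose: "\<lbrakk>x \<in> D (length g); length f = sum_list (map leaves g)\<rbrakk>
      \<Longrightarrow> act (forest_compose f g) x = act f (act g x)"
    and act_id: "x \<in> D n \<Longrightarrow> act (replicate n Leaf) x = x"
    and act_inj: "\<lbrakk>x \<in> D (length f); y \<in> D (length f); act f x = act f y\<rbrakk> \<Longrightarrow> x = y"
begin

inductive step :: "tree \<times> 'x \<Rightarrow> tree \<times> 'x \<Rightarrow> bool" where
  "\<lbrakk>x \<in> D (leaves t); length f = leaves t\<rbrakk> \<Longrightarrow> step (t, x) (graft f t, act f x)"

definition cls :: "tree \<Rightarrow> 'x \<Rightarrow> (tree \<times> 'x) set" where
  "cls t x = {p. equivclp step (t, x) p}"

lemma cls_eq_iff: "cls t x = cls t' x' \<longleftrightarrow> equivclp step (t, x) (t', x')"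
proof
  assume "cls t x = cls t' x'"
  moreover have "(t', x') \<in> cls t' x'"
    by (simp add: cls_def)
  ultimately have "(t', x') \<in> cls t x"
    by simp
  then show "equivclp step (t, x) (t', x')"
    by (simp add: cls_def)
next
  assume *: "equivclp step (t, x) (t', x')"
  show "cls t x = cls t' x'"
    unfolding cls_def using equivclp_trans[OF *] equivclp_trans[OF equivclp_sym[OF *]] by blast
qed

lemma act_leaves:
  "\<lbrakk>x \<in> D (leaves t); length f = leaves t\<rbrakk> \<Longrightarrow> act f x \<in> D (leaves (graft f t))"
  using act_closed[of x f] by (simp add: leaves_graft)

lemma cls_graft: "\<lbrakk>x \<in> D (leaves t); length f = leaves t\<rbrakk> \<Longrightarrow> cls (graft f t) (act f x) = cls t x"
  unfolding cls_eq_iff by (meson step.intros equivclp_sym r_into_equivclp)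

text \<open>A closed description of the equivalence generated by \<open>step\<close>: the data
  coincide on every common refinement. Quantifying over all refinements, not just one, makes classes
  separable, since the trivial forests may be inserted.\<close>

definition agree :: "tree \<times> 'x \<Rightarrow> tree \<times> 'x \<Rightarrow> bool" where
  "agree p q \<longleftrightarrow> snd p \<in> D (leaves (fst p)) \<and> snd q \<in> D (leaves (fst q)) \<and>
     (\<forall>f g. length f = leaves (fst p) \<longrightarrow> length g = leaves (fst q) \<longrightarrow>
        graft f (fst p) = graft g (fst q) \<longrightarrow> act f (snd p) = act g (snd q))"

lemma agree_sym: "agree p q \<Longrightarrow> agree q p"
  unfolding agree_def by metis

lemma agree_step: "step p q \<Longrightarrow> agree p q"
proof (induction rule: step.induct)
  case (1 x t f)
  have "act g x = act h (act f x)"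
    if "length g = leaves t" "length h = leaves (graft f t)" "graft g t = graft h (graft f t)" for g h
  proof -
    have h: "length h = sum_list (map leaves f)"
      using that 1 by (simp add: leaves_graft)
    then have "g = forest_compose h f"
      using that 1 by (intro graft_left_cancel[of _ t]) (auto simp: graft_graft)
    then show ?thesis
      using act_compose[of x f h] 1 h by simp
  qed
  then show ?case
    unfolding agree_def using 1 act_leaves by simp
qed

text \<open>A common refinement of the outer two trees need not refine the middle one. Refining
  further by \<open>h\<close> reaches the middle tree, where the data are equal, and injectivity of
  \<open>act h\<close> brings the equality back down.\<close>

lemma agree_trans:
  assumes "agree p q" "agree q r"
  shows "agree p r"
proof -
  obtain t x t' y s z where [simp]: "p = (t, x)" "q = (s, z)" "r = (t', y)"
    by (metis surj_pair)
  have D: "x \<in> D (leaves t)" "z \<in> D (leaves s)" "y \<in> D (leaves t')"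
    using assms by (auto simp: agree_def)
  have "act f x = act g y"
    if fg: "length f = leaves t" "length g = leaves t'" "graft f t = graft g t'" for f g
  proof -
    obtain h k where hk: "length h = leaves (graft f t)" "length k = leaves s"
        "graft h (graft f t) = graft k s"
      using common_refinement by blast
    have h: "length h = sum_list (map leaves f)" "length h = sum_list (map leaves g)"
      using hk fg leaves_graft[of f t] leaves_graft[of g t'] by auto
    have "act (forest_compose h f) x = act k z"
      using assms(1) fg hk h by (auto simp: agree_def graft_graft[symmetric])
    moreover have "graft h (graft g t') = graft k s"
      using hk fg by simp
    then have "act k z = act (forest_compose h g) y"
      using assms(2) fg hk h by (auto simp: agree_def graft_graft)
    ultimately have *: "act h (act f x) = act h (act g y)"
      using act_compose[of x f h] act_compose[of y g h] D fg h by simp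
    have "act f x \<in> D (length h)" "act g y \<in> D (length h)"
      using act_leaves[of x t f] act_leaves[of y t' g] D fg hk by auto
    then show ?thesis
      using act_inj * by blast
  qed
  then show ?thesis
    using D by (auto simp: agree_def)
qed

text \<open>The membership assumption is for the reflexive case: any pair is equivalent to itself,
  but \<open>agree\<close> demands a valid datum. In that case the two forests are equal by left
  cancellation.\<close>

lemma agree_equivclp:
  assumes "equivclp step p q" "snd p \<in> D (leaves (fst p))"
  shows "agree p q"
  using assms
proof (induction rule: equivclp_induct)
  case base
  then show ?case
    using graft_left_cancel by (fastforce simp: agree_def)
next
  case (step y z)
  then show ?case
    using agree_step agree_sym agree_trans by blast
qed

text \<open>Trivial forests in \<open>agree\<close> give the equality. In other words, each stage of
  the directed system embeds into its limit.\<close>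

lemma cls_inj:
  assumes "cls t x = cls t y" "x \<in> D (leaves t)"
  shows "x = y"
proof -
  have ag: "agree (t, x) (t, y)"
    using assms agree_equivclp[of "(t, x)" "(t, y)"] by (simp add: cls_eq_iff)
  then have y: "y \<in> D (leaves t)"
    by (simp add: agree_def)
  have "act (replicate (leaves t) Leaf) x = act (replicate (leaves t) Leaf) y"
    using ag by (simp add: agree_def)
  then show ?thesis
    using act_id[OF y] act_id[OF assms(2)] by simp
qed

lemma cls_refine:
  assumes "x \<in> D (leaves t)"
  obtains f x' where "length f = leaves s" "x' \<in> D (leaves (graft f s))"
    "cls t x = cls (graft f s) x'"
proof -
  obtain g f where *: "length g = leaves t" "length f = leaves s" "graft g t = graft f s"
    using common_refinement by blast
  show ?thesis
    using that[of f "act g x"] cls_graft[of x t g] act_leaves[of x t g] * assms by simp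
qed

lemma cls_eqD:
  assumes "cls t x = cls s y" "length f = leaves t" "length g = leaves s" "graft f t = graft g s"
    and "x \<in> D (leaves t)" "y \<in> D (leaves s)"
  shows "act f x = act g y"
proof -
  have "cls (graft f t) (act f x) = cls (graft f t) (act g y)"
    using assms cls_graft[of x t f] cls_graft[of y s g] by simp
  then show ?thesis
    using cls_inj act_leaves[of x t f] assms by blast
qed

lemma cls_common_finite:
  assumes "finite Z" "Z \<subseteq> {cls t x |t x. x \<in> D (leaves t)}"
  shows "\<exists>u. \<forall>z\<in>Z. \<exists>x\<in>D (leaves u). z = cls u x"
  using assms
proof (induction Z rule: finite_induct)
  case empty
  then show ?case by simp
next
  case (insert z Z)
  then obtain u where u: "\<And>w. w \<in> Z \<Longrightarrow> \<exists>x\<in>D (leaves u). w = cls u x"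
    by auto
  obtain t x where z: "z = cls t x" "x \<in> D (leaves t)"
    using insert.prems by blast
  obtain f x' where f: "length f = leaves u" "x' \<in> D (leaves (graft f u))" "cls t x = cls (graft f u) x'"
    using cls_refine z(2) by blast
  have "\<exists>y\<in>D (leaves (graft f u)). w = cls (graft f u) y" if "w \<in> Z" for w
    using u[OF that] act_leaves[of _ u f] cls_graft[of _ u f] f(1) by metis
  then show ?case
    using z f by (intro exI[of _ "graft f u"]) auto
qed

end

text \<open>In \<open>[t, s]\<close> the tree \<open>t\<close> plays the role of the base and
  \<open>s\<close> that of the datum on its leaves.\<close>

interpretation thompson: forest_action "\<lambda>n. {s. leaves s = n}" graft
proof
  show "x \<in> {s. leaves s = length f} \<Longrightarrow> graft f x \<in> {s. leaves s = sum_list (map leaves f)}" for x f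
    by (simp add: leaves_graft)
  show "graft (forest_compose f g) x = graft f (graft g x)"
    if "x \<in> {s. leaves s = length g}" "length f = sum_list (map leaves g)" for x f g
    using that by (simp add: graft_graft)
  show "graft (replicate n Leaf) x = x" if "x \<in> {s. leaves s = n}" for x n
    using that by auto
  show "x = y" if "x \<in> {s. leaves s = length f}" "y \<in> {s. leaves s = length f}" "graft f x = graft f y"
    for x y f
    using that graft_right_cancel[of f x y] by simp
qed

lemma pair_step_eq: "pair_step = thompson.step"
  by (auto simp: fun_eq_iff pair_step.simps thompson.step.simps)

lemma fclass_eq: "fclass = thompson.cls"
  by (simp add: fun_eq_iff fclass_def thompson.cls_def pair_step_eq)

lemma fclass_graft:
  "\<lbrakk>leaves t = leaves s; length f = leaves s\<rbrakk> \<Longrightarrow> fclass (graft f t) (graft f s) = fclass t s"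
  using thompson.cls_graft[of s t f] by (simp add: fclass_eq)

text \<open>The interpretation treats the two trees asymmetrically, and \<open>cls_inj\<close> only
  compares second components. Swapping, that is inversion in \<open>F\<close>, yields the version
  for first components in \<open>fclass_inj_left\<close>.\<close>

lemma equivclp_pair_step_swap:
  assumes "equivclp pair_step p q"
  shows "equivclp pair_step (prod.swap p) (prod.swap q)"
  using assms
proof (induction rule: equivclp_induct)
  case base
  then show ?case by simp
next
  case (step y z)
  have "pair_step (prod.swap y) (prod.swap z)" if "pair_step y z" for y z
    using that by (cases rule: pair_step.cases) (auto intro: pair_step.intros)
  then have "equivclp pair_step (prod.swap y) (prod.swap z)"
    using step.hyps(2) by (meson equivclp_sym r_into_equivclp)
  then show ?case
    using step.IH equivclp_trans by metis
qed

lemma fclass_eq_iff: "fclass t s = fclass t' s' \<longleftrightarrow> equivclp pair_step (t, s) (t', s')"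
  unfolding fclass_eq pair_step_eq by (rule thompson.cls_eq_iff)

lemma fclass_swap: "fclass t s = fclass t' s' \<Longrightarrow> fclass s t = fclass s' t'"
  unfolding fclass_eq_iff using equivclp_pair_step_swap[of "(t, s)" "(t', s')"] by simp

lemma fclass_inj_left: "\<lbrakk>fclass t s = fclass t' s; leaves t = leaves s\<rbrakk> \<Longrightarrow> t = t'"
  using thompson.cls_inj[of s t t'] fclass_swap[of t s t' s] by (simp add: fclass_eq)

context forest_action
begin

text \<open>Over a common refinement of \<open>s\<close> and \<open>s'\<close> the two data coincide
  because classes embed, and the two refined target trees coincide by
  \<open>fclass_inj_left\<close>. One argument covers the action on decorated trees and the product
  of \<open>F\<close>.\<close>

lemma action_well_defined:
  assumes "fclass t s = fclass t' s'" "cls s x = cls s' x'"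
    and "leaves t = leaves s" "leaves t' = leaves s'" "x \<in> D (leaves s)" "x' \<in> D (leaves s')"
  shows "cls t x = cls t' x'"
proof -
  obtain f g where fg: "length f = leaves s" "length g = leaves s'" "graft f s = graft g s'"
    using common_refinement by blast
  have "fclass (graft f t) (graft f s) = fclass (graft g t') (graft g s')"
    using assms fg(1,2) by (simp add: fclass_graft)
  then have t: "graft f t = graft g t'"
    using fg leaves_graft[of f t] leaves_graft[of f s] assms
    by (intro fclass_inj_left[of _ "graft f s"]) auto
  have "cls (graft f s) (act f x) = cls (graft g s') (act g x')"
    using assms fg(1,2) by (simp add: cls_graft)
  then have x: "act f x = act g x'"
    using cls_inj[of "graft f s"] fg act_leaves[of x s f] assms by simp
  show ?thesis
    using cls_graft[of x t f] cls_graft[of x' t' g] t x assms fg by simp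
qed

lemma action_representatives:
  assumes "leaves t = leaves s" "x \<in> D (leaves u)"
  obtains t' s' x' where "leaves t' = leaves s'" "x' \<in> D (leaves s')"
    "fclass t s = fclass t' s'" "cls u x = cls s' x'"
proof -
  obtain f x' where "length f = leaves s" "x' \<in> D (leaves (graft f s))" "cls u x = cls (graft f s) x'"
    using cls_refine assms(2) by blast
  then show ?thesis
    using that[of "graft f t" "graft f s" x'] assms by (simp add: fclass_graft leaves_graft)
qed

end

section \<open>The group structure of Thompson's group\<close>

lemma carrier_thompson: "carrier thompson_F = {fclass t s |t s. leaves t = leaves s}"
  by (simp add: thompson_F_def)

lemma fclass_carrier [simp]: "leaves t = leaves s \<Longrightarrow> fclass t s \<in> carrier thompson_F"
  by (auto simp: carrier_thompson)

text \<open>The product \<open>[t, s][s, u] = [t, u]\<close> is the action of \<open>[t, s]\<close>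
  on the class of \<open>(s, u)\<close>, with the tree \<open>u\<close> as datum.\<close>

lemma fclass_mult_well_defined:
  assumes "fclass t s = fclass t' s'" "fclass s u = fclass s' u'"
    and "leaves t = leaves s" "leaves t' = leaves s'" "leaves s = leaves u" "leaves s' = leaves u'"
  shows "fclass t u = fclass t' u'"
  unfolding fclass_eq
  by (rule thompson.action_well_defined[OF assms(1) assms(2)[unfolded fclass_eq] assms(3,4)])
    (use assms(5,6) in simp_all)

lemma fclass_mult:
  assumes "leaves t = leaves s" "leaves s = leaves u"
  shows "fclass t s \<otimes>\<^bsub>thompson_F\<^esub> fclass s u = fclass t u"
proof -
  have "fclass t s \<otimes>\<^bsub>thompson_F\<^esub> fclass s u =
    (THE k. \<exists>t1 s1 t' s' f f'. leaves t1 = leaves s1 \<and> leaves t' = leaves s' \<and> fclass t s = fclass t1 s1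
       \<and> fclass s u = fclass t' s' \<and> length f = leaves s1 \<and> length f' = leaves t' \<and> graft f s1 = graft f' t'
       \<and> k = fclass (graft f t1) (graft f' s'))"
    by (simp add: thompson_F_def)
  also have "\<dots> = fclass t u"
  proof (rule the_equality)
    let ?r = "replicate (leaves s) Leaf"
    show "\<exists>t1 s1 t' s' f f'. leaves t1 = leaves s1 \<and> leaves t' = leaves s' \<and> fclass t s = fclass t1 s1
       \<and> fclass s u = fclass t' s' \<and> length f = leaves s1 \<and> length f' = leaves t' \<and> graft f s1 = graft f' t'
       \<and> fclass t u = fclass (graft f t1) (graft f' s')"
      by (rule exI[of _ t], rule exI[of _ s], rule exI[of _ s], rule exI[of _ u], rule exI[of _ ?r],
          rule exI[of _ ?r]) (use assms graft_replicate_Leaf[of t] graft_replicate_Leaf[of u] in simp)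
  next
    fix k
    assume "\<exists>t1 s1 t' s' f f'. leaves t1 = leaves s1 \<and> leaves t' = leaves s' \<and> fclass t s = fclass t1 s1
       \<and> fclass s u = fclass t' s' \<and> length f = leaves s1 \<and> length f' = leaves t' \<and> graft f s1 = graft f' t'
       \<and> k = fclass (graft f t1) (graft f' s')"
    then obtain t1 s1 t' s' f f' where *: "leaves t1 = leaves s1" "leaves t' = leaves s'"
      "fclass t s = fclass t1 s1" "fclass s u = fclass t' s'" "length f = leaves s1"
      "length f' = leaves t'" "graft f s1 = graft f' t'" "k = fclass (graft f t1) (graft f' s')"
      by blast
    have 1: "fclass t s = fclass (graft f t1) (graft f s1)" "fclass s u = fclass (graft f s1) (graft f' s')"
      using * fclass_graft[of t1 s1 f] fclass_graft[of t' s' f'] by auto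
    have 2: "leaves (graft f t1) = leaves (graft f s1)" "leaves (graft f s1) = leaves (graft f' s')"
      using leaves_graft[of f t1] leaves_graft[of f s1] leaves_graft[of f' t'] leaves_graft[of f' s'] *
      by (simp_all only:)
    have "fclass t u = fclass (graft f t1) (graft f' s')"
      by (rule fclass_mult_well_defined[OF 1 assms(1) 2(1) assms(2) 2(2)])
    then show "k = fclass t u"
      using *(8) by (simp only:)
  qed
  finally show ?thesis .
qed

lemma thompson_representatives:
  assumes "g \<in> carrier thompson_F" "h \<in> carrier thompson_F"
  obtains t s u where "leaves t = leaves s" "leaves s = leaves u" "g = fclass t s" "h = fclass s u"
proof -
  obtain t s a b where *: "leaves t = leaves s" "g = fclass t s" "leaves a = leaves b" "h = fclass a b"
    using assms by (auto simp: carrier_thompson)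
  obtain t' s' b' where 1: "leaves t' = leaves s'" "b' \<in> {u. leaves u = leaves s'}"
    "fclass t s = fclass t' s'" "thompson.cls a b = thompson.cls s' b'"
    by (rule thompson.action_representatives[of t s b a]) (use * in auto)
  have "h = fclass s' b'"
    unfolding *(4) fclass_eq by (rule 1(4))
  moreover have "g = fclass t' s'"
    unfolding *(2) by (rule 1(3))
  ultimately show ?thesis
    using that[of t' s' b'] 1(1,2) by simp
qed

lemma one_thompson: "\<one>\<^bsub>thompson_F\<^esub> = fclass t t"
  using fclass_graft[of Leaf Leaf "[t]"] by (simp add: thompson_F_def)

lemma group_thompson: "group thompson_F"
proof (rule groupI)
  show "x \<otimes>\<^bsub>thompson_F\<^esub> y \<in> carrier thompson_F"
    if xy: "x \<in> carrier thompson_F" "y \<in> carrier thompson_F" for x y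
  proof -
    obtain t s u where "leaves t = leaves s" "leaves s = leaves u" "x = fclass t s" "y = fclass s u"
      using thompson_representatives xy by blast
    then show ?thesis by (simp add: fclass_mult)
  qed
  show "\<one>\<^bsub>thompson_F\<^esub> \<in> carrier thompson_F"
    by (simp add: one_thompson[of Leaf])
  show "\<one>\<^bsub>thompson_F\<^esub> \<otimes>\<^bsub>thompson_F\<^esub> x = x" if x: "x \<in> carrier thompson_F" for x
  proof -
    obtain t s where "leaves t = leaves s" "x = fclass t s"
      using x by (auto simp: carrier_thompson)
    then show ?thesis
      by (simp add: one_thompson[of t] fclass_mult)
  qed
  show "\<exists>y\<in>carrier thompson_F. y \<otimes>\<^bsub>thompson_F\<^esub> x = \<one>\<^bsub>thompson_F\<^esub>" if x: "x \<in> carrier thompson_F" for x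
  proof -
    obtain t s where *: "leaves t = leaves s" "x = fclass t s"
      using x by (auto simp: carrier_thompson)
    show ?thesis
      by (rule bexI[of _ "fclass s t"]) (use * in \<open>simp_all add: one_thompson[of s] fclass_mult\<close>)
  qed
  show "x \<otimes>\<^bsub>thompson_F\<^esub> y \<otimes>\<^bsub>thompson_F\<^esub> z = x \<otimes>\<^bsub>thompson_F\<^esub> (y \<otimes>\<^bsub>thompson_F\<^esub> z)"
    if xyz: "x \<in> carrier thompson_F" "y \<in> carrier thompson_F" "z \<in> carrier thompson_F" for x y z
  proof -
    obtain t s u where 1: "leaves t = leaves s" "leaves s = leaves u" "x = fclass t s" "y = fclass s u"
      using thompson_representatives xyz by blast
    obtain a b where 2: "leaves a = leaves b" "z = fclass a b"
      using xyz by (auto simp: carrier_thompson)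
    \<comment> \<open>The third factor is rewritten to start at a refinement of \<open>u\<close>.
      Refining the first two factors along the same forest gives a chain of four trees in which both
      bracketings telescope.\<close>
    obtain f b' where "length f = leaves u" "b' \<in> {v. leaves v = leaves (graft f u)}"
        "thompson.cls a b = thompson.cls (graft f u) b'"
      by (rule thompson.cls_refine[of b a u]) (use 2 in auto)
    then have 3: "length f = leaves u" "leaves b' = leaves (graft f u)" "z = fclass (graft f u) b'"
      unfolding 2(2) fclass_eq by blast+
    have x: "x = fclass (graft f t) (graft f s)" and y: "y = fclass (graft f s) (graft f u)"
      using 1 3 by (auto simp: fclass_graft)
    have "leaves (graft f t) = leaves (graft f u)" "leaves (graft f s) = leaves (graft f u)"
      using 1 3 by (auto simp: leaves_graft)
    then show ?thesis
      using 3 by (simp add: x y fclass_mult)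
  qed
qed

section \<open>Pre-Hilbert spaces and their completions\<close>

lemma sum_list_eq_0: "(\<And>b. b \<in> set bs \<Longrightarrow> f b = 0) \<Longrightarrow> (\<Sum>b\<leftarrow>bs. f b) = (0 :: 'b :: monoid_add)"
  by (induction bs) auto

context pre_hilbert_space
begin

abbreviation vdiff :: "'a \<Rightarrow> 'a \<Rightarrow> 'a" where
  "vdiff x y \<equiv> vadd X x (vscale X (-1) y)"

lemma scale_zero_left [simp]:
  assumes "x \<in> carrier X"
  shows "vscale X 0 x = vzero X"
proof -
  let ?z = "vscale X 0 x"
  have z: "?z \<in> carrier X"
    using assms scale_closed by blast
  obtain y where y: "y \<in> carrier X" "vadd X ?z y = vzero X"
    using add_inverse z by blast
  have "vadd X ?z ?z = ?z"
    using scale_add_left[OF assms, of 0 0] by simp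
  then have "vadd X ?z (vadd X ?z y) = vadd X ?z y"
    using add_assoc[OF z z y(1)] by simp
  then show ?thesis
    using y add_zero z by simp
qed

lemma scale_zero_right: "vscale X c (vzero X) = vzero X"
  using scale_scale[OF zero_closed, of c 0] zero_closed by simp

lemma diff_self [simp]: "x \<in> carrier X \<Longrightarrow> vdiff x x = vzero X"
  using scale_add_left[of x 1 "-1"] scale_one[of x] by simp

lemma diff_closed: "\<lbrakk>x \<in> carrier X; y \<in> carrier X\<rbrakk> \<Longrightarrow> vdiff x y \<in> carrier X"
  by (intro add_closed scale_closed)

lemma zero_add: "x \<in> carrier X \<Longrightarrow> vadd X (vzero X) x = x"
  using add_commute[of x "vzero X"] add_zero[of x] zero_closed by simp

lemma diff_add_cancel: "\<lbrakk>x \<in> carrier X; y \<in> carrier X\<rbrakk> \<Longrightarrow> vadd X (vdiff x y) y = x"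
  using add_assoc[of x "vscale X (-1) y" y] add_commute[of "vscale X (-1) y" y]
  by (simp add: scale_closed add_zero)

lemma inner_zero_left [simp]: "y \<in> carrier X \<Longrightarrow> vinner X (vzero X) y = 0"
  using inner_scale_left[of "vzero X" y 0] zero_closed by simp

lemma inner_add_right:
  "\<lbrakk>x \<in> carrier X; y \<in> carrier X; z \<in> carrier X\<rbrakk>
     \<Longrightarrow> vinner X z (vadd X x y) = vinner X z x + vinner X z y"
  using inner_commute[of z "vadd X x y"] inner_commute[of z x] inner_commute[of z y]
  by (simp add: add_closed inner_add_left)

lemma inner_scale_right:
  "\<lbrakk>x \<in> carrier X; y \<in> carrier X\<rbrakk> \<Longrightarrow> vinner X x (vscale X c y) = cnj c * vinner X x y"
  using inner_commute[of x "vscale X c y"] inner_commute[of x y]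
  by (simp add: scale_closed inner_scale_left)

lemma inner_zero_right [simp]: "y \<in> carrier X \<Longrightarrow> vinner X y (vzero X) = 0"
  using inner_commute[of y "vzero X"] zero_closed by simp

lemma Re_inner_self_nonneg: "x \<in> carrier X \<Longrightarrow> 0 \<le> Re (vinner X x x)"
  using inner_pos[of x] by (cases "x = vzero X") auto

lemma inner_self: "x \<in> carrier X \<Longrightarrow> vinner X x x = complex_of_real ((vnorm X x)\<^sup>2)"
proof -
  assume x: "x \<in> carrier X"
  have "Im (vinner X x x) = 0"
    using inner_commute[OF x x] by (metis add.inverse_inverse cnj.simps(2) equal_neg_zero)
  then show ?thesis
    using Re_inner_self_nonneg[OF x] by (simp add: vnorm_def complex_eq_iff)
qed

lemma norm_nonneg [simp]: "x \<in> carrier X \<Longrightarrow> 0 \<le> vnorm X x"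
  by (simp add: vnorm_def Re_inner_self_nonneg)

lemma norm_eq_0: "x \<in> carrier X \<Longrightarrow> vnorm X x = 0 \<longleftrightarrow> x = vzero X"
  using inner_pos[of x] by (cases "x = vzero X") (auto simp: vnorm_def)

lemma norm_zero [simp]: "vnorm X (vzero X) = 0"
  by (simp add: norm_eq_0 zero_closed)

lemma Cauchy_Schwarz:
  assumes "x \<in> carrier X" "y \<in> carrier X"
  shows "cmod (vinner X x y) \<le> vnorm X x * vnorm X y"
proof (cases "y = vzero X")
  case True
  then show ?thesis using assms by simp
next
  case False
  let ?n = "(vnorm X y)\<^sup>2" and ?i = "vinner X x y"
  have n: "?n > 0"
    using False assms norm_eq_0[of y] by simp
  \<comment> \<open>This is the component of \<open>x\<close> orthogonal to \<open>y\<close>,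
    multiplied by the squared norm of \<open>y\<close> to avoid division.\<close>
  define z where "z = vadd X (vscale X ?n x) (vscale X (- ?i) y)"
  have z: "z \<in> carrier X"
    unfolding z_def using assms by (intro add_closed scale_closed)
  have yx: "vinner X y x = cnj ?i"
    using assms inner_commute by blast
  have "vinner X z z = ?n * ?n * (vnorm X x)\<^sup>2 - ?n * (?i * cnj ?i)"
    unfolding z_def using assms
    by (simp add: inner_add_left inner_add_right inner_scale_left inner_scale_right scale_closed add_closed
        inner_self[of x] inner_self[of y] yx algebra_simps)
  also have "\<dots> = of_real (?n * (?n * (vnorm X x)\<^sup>2 - (cmod ?i)\<^sup>2))"
    by (simp add: complex_norm_square[symmetric] algebra_simps)
  finally have "vinner X z z = of_real (?n * (?n * (vnorm X x)\<^sup>2 - (cmod ?i)\<^sup>2))" .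
  then have "0 \<le> ?n * (?n * (vnorm X x)\<^sup>2 - (cmod ?i)\<^sup>2)"
    using Re_inner_self_nonneg[OF z] by simp
  then have "(cmod ?i)\<^sup>2 \<le> ?n * (vnorm X x)\<^sup>2"
    using n by (simp add: zero_le_mult_iff)
  then have "(cmod ?i)\<^sup>2 \<le> (vnorm X x * vnorm X y)\<^sup>2"
    by (simp add: power_mult_distrib mult.commute)
  then show ?thesis
    by (rule power2_le_imp_le) (use assms in auto)
qed

lemma norm_triangle:
  assumes "x \<in> carrier X" "y \<in> carrier X"
  shows "vnorm X (vadd X x y) \<le> vnorm X x + vnorm X y"
proof -
  have xy: "vadd X x y \<in> carrier X"
    using assms add_closed by blast
  have "(vnorm X (vadd X x y))\<^sup>2 = Re (vinner X (vadd X x y) (vadd X x y))"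
    using inner_self[OF xy] by simp
  also have "\<dots> = (vnorm X x)\<^sup>2 + (vnorm X y)\<^sup>2 + Re (vinner X x y) + Re (vinner X y x)"
    using assms
    by (simp add: inner_add_left inner_add_right add_closed inner_self[of x] inner_self[of y])
  also have "\<dots> \<le> (vnorm X x)\<^sup>2 + (vnorm X y)\<^sup>2 + vnorm X x * vnorm X y + vnorm X y * vnorm X x"
    using Cauchy_Schwarz[OF assms] Cauchy_Schwarz[OF assms(2,1)]
      complex_Re_le_cmod[of "vinner X x y"] complex_Re_le_cmod[of "vinner X y x"] by linarith
  also have "\<dots> = (vnorm X x + vnorm X y)\<^sup>2"
    by (simp add: power2_eq_square algebra_simps)
  finally show ?thesis
    by (rule power2_le_imp_le) (use assms in auto)
qed

lemma norm_scale: "x \<in> carrier X \<Longrightarrow> vnorm X (vscale X c x) = cmod c * vnorm X x"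
proof -
  assume x: "x \<in> carrier X"
  have "vinner X (vscale X c x) (vscale X c x) = (c * cnj c) * (vnorm X x)\<^sup>2"
    using x by (simp add: inner_scale_left inner_scale_right scale_closed inner_self[of x])
  also have "\<dots> = of_real ((cmod c * vnorm X x)\<^sup>2)"
    by (simp add: complex_norm_square[symmetric] power_mult_distrib)
  finally show ?thesis
    using x by (simp add: vnorm_def Re_inner_self_nonneg)
qed

lemma dist_self [simp]: "x \<in> carrier X \<Longrightarrow> vdist X x x = 0"
  by (simp add: vdist_def)

lemma dist_nonneg [simp]: "\<lbrakk>x \<in> carrier X; y \<in> carrier X\<rbrakk> \<Longrightarrow> 0 \<le> vdist X x y"
  by (simp add: vdist_def diff_closed)

lemma dist_zero: "x \<in> carrier X \<Longrightarrow> vdist X x (vzero X) = vnorm X x"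
  by (simp add: vdist_def scale_zero_right add_zero)

lemma dist_commute:
  assumes "x \<in> carrier X" "y \<in> carrier X"
  shows "vdist X x y = vdist X y x"
proof -
  have "vscale X (-1) (vdiff x y) = vdiff y x"
    using assms add_commute[of "vscale X (-1) x" y]
    by (simp add: scale_add_right scale_closed scale_scale scale_one)
  then show ?thesis
    using norm_scale[OF diff_closed[OF assms], of "-1"] by (simp add: vdist_def)
qed

lemma dist_triangle:
  assumes "x \<in> carrier X" "y \<in> carrier X" "z \<in> carrier X"
  shows "vdist X x z \<le> vdist X x y + vdist X y z"
proof -
  have "vadd X (vdiff x y) (vdiff y z) = vadd X (vadd X (vdiff x y) y) (vscale X (-1) z)"
    using assms by (subst add_assoc) (auto simp: diff_closed scale_closed)
  also have "\<dots> = vdiff x z"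
    using assms by (simp add: diff_add_cancel)
  finally show ?thesis
    using norm_triangle[OF diff_closed[OF assms(1,2)] diff_closed[OF assms(2,3)]] by (simp add: vdist_def)
qed

lemma norm_le_dist:
  assumes "x \<in> carrier X" "y \<in> carrier X"
  shows "vnorm X x \<le> vdist X x y + vnorm X y"
  using norm_triangle[OF diff_closed[OF assms] assms(2)] assms
  by (simp add: vdist_def diff_add_cancel)

lemma inner_perturb:
  assumes "x \<in> carrier X" "y \<in> carrier X" "x' \<in> carrier X" "y' \<in> carrier X"
  shows "cmod (vinner X x y - vinner X x' y') \<le> vdist X x x' * vnorm X y + vnorm X x' * vdist X y y'"
proof -
  have "vinner X x y - vinner X x' y' = vinner X (vdiff x x') y + vinner X x' (vdiff y y')"
    using assms by (simp add: inner_add_left inner_add_right inner_scale_left inner_scale_right scale_closed)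
  also have "cmod \<dots> \<le> cmod (vinner X (vdiff x x') y) + cmod (vinner X x' (vdiff y y'))"
    by (rule norm_triangle_ineq)
  also have "\<dots> \<le> vnorm X (vdiff x x') * vnorm X y + vnorm X x' * vnorm X (vdiff y y')"
    using assms by (intro add_mono Cauchy_Schwarz) (auto simp: diff_closed)
  finally show ?thesis by (simp add: vdist_def)
qed

text \<open>For an orthonormal list this is the orthogonal projection onto its span.\<close>

fun bessel_sum :: "'a list \<Rightarrow> 'a \<Rightarrow> 'a" where
  "bessel_sum [] x = vzero X"
| "bessel_sum (e # es) x = vadd X (vscale X (vinner X x e) e) (bessel_sum es x)"

lemma bessel_sum_closed: "set es \<subseteq> carrier X \<Longrightarrow> bessel_sum es x \<in> carrier X"
  by (induction es) (auto simp: zero_closed add_closed scale_closed)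

lemma inner_bessel_sum:
  assumes "set es \<subseteq> carrier X" "y \<in> carrier X"
  shows "vinner X (bessel_sum es x) y = (\<Sum>e\<leftarrow>es. vinner X x e * vinner X e y)"
  using assms
  by (induction es) (auto simp: bessel_sum_closed inner_add_left inner_scale_left scale_closed)

lemma bessel_sum_add:
  assumes "set es \<subseteq> carrier X" "x \<in> carrier X" "y \<in> carrier X"
  shows "bessel_sum es (vadd X x y) = vadd X (bessel_sum es x) (bessel_sum es y)"
  using assms
proof (induction es)
  case Nil
  then show ?case by (simp add: add_zero zero_closed)
next
  case (Cons e es)
  let ?a = "vscale X (vinner X x e) e" and ?b = "vscale X (vinner X y e) e"
  let ?s = "bessel_sum es x" and ?t = "bessel_sum es y"
  have c: "?a \<in> carrier X" "?b \<in> carrier X" "?s \<in> carrier X" "?t \<in> carrier X"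
    using Cons.prems by (auto simp: scale_closed bessel_sum_closed)
  have "vadd X (vadd X ?a ?b) (vadd X ?s ?t) = vadd X ?a (vadd X ?b (vadd X ?s ?t))"
    using c by (simp add: add_assoc add_closed)
  also have "vadd X ?b (vadd X ?s ?t) = vadd X ?s (vadd X ?b ?t)"
    using c add_assoc[of ?b ?s ?t] add_commute[of ?b ?s] add_assoc[of ?s ?b ?t] by simp
  also have "vadd X ?a (vadd X ?s (vadd X ?b ?t)) = vadd X (vadd X ?a ?s) (vadd X ?b ?t)"
    using c by (simp add: add_assoc add_closed)
  finally show ?case
    using Cons by (simp add: inner_add_left scale_add_left)
qed

lemma bessel_sum_scale:
  assumes "set es \<subseteq> carrier X" "x \<in> carrier X"
  shows "bessel_sum es (vscale X c x) = vscale X c (bessel_sum es x)"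
  using assms
proof (induction es)
  case Nil
  then show ?case by (simp add: scale_zero_right)
next
  case (Cons e es)
  then show ?case
    by (simp add: inner_scale_left scale_add_right scale_closed bessel_sum_closed scale_scale)
qed

text \<open>As \<open>cspan\<close> is an intersection of subspaces, this is how the reproducing
  formula passes from generators to their whole span.\<close>

lemma csubspace_bessel_fixed:
  assumes "set es \<subseteq> carrier X"
  shows "csubspace X {x \<in> carrier X. bessel_sum es x = x}"
proof -
  have "bessel_sum es (vzero X) = vzero X"
    using bessel_sum_scale[OF assms zero_closed, of 0] bessel_sum_closed[OF assms] zero_closed by simp
  then show ?thesis
    unfolding csubspace_def using assms
    by (auto simp: zero_closed add_closed scale_closed bessel_sum_add bessel_sum_scale)
qed

text \<open>Pairs are compared in list order only; the reverse order follows by conjugate symmetry.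
  Repetitions are excluded, since a repeated entry would have inner product both \<open>0\<close>
  and \<open>1\<close> with itself.\<close>

definition orthonormal :: "'a list \<Rightarrow> bool" where
  "orthonormal es \<longleftrightarrow> set es \<subseteq> carrier X \<and> (\<forall>e\<in>set es. vinner X e e = 1) \<and>
     sorted_wrt (\<lambda>e e'. vinner X e e' = 0) es"

lemma inner_bessel_sum_orthonormal:
  assumes "orthonormal es" "x \<in> carrier X" "e \<in> set es"
  shows "vinner X (bessel_sum es x) e = vinner X x e"
  using assms
proof (induction es)
  case Nil
  then show ?case by simp
next
  case (Cons a es)
  have c: "a \<in> carrier X" "set es \<subseteq> carrier X" "e \<in> carrier X"
    and a: "vinner X a a = 1" and ortho: "\<And>b. b \<in> set es \<Longrightarrow> vinner X a b = 0" and es: "orthonormal es"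
    using Cons.prems by (auto simp: orthonormal_def)
  have ortho': "vinner X b a = 0" if "b \<in> set es" for b
    using ortho[OF that] inner_commute[of b a] c that by auto
  have *: "vinner X (bessel_sum (a # es) x) e
      = vinner X x a * vinner X a e + vinner X (bessel_sum es x) e"
    using c by (simp add: inner_add_left inner_scale_left scale_closed bessel_sum_closed)
  show ?case
  proof (cases "e \<in> set es")
    case True
    then show ?thesis using * Cons.IH es ortho assms(2) by simp
  next
    case False
    then have e: "e = a"
      using Cons.prems by simp
    have "(\<Sum>b\<leftarrow>es. vinner X x b * vinner X b a) = 0"
      using ortho' by (intro sum_list_eq_0) simp
    then have "vinner X (bessel_sum es x) a = 0"
      using c by (simp add: inner_bessel_sum)
    then show ?thesis using * e a by simp
  qed
qed

text \<open>One Gram-Schmidt step: the normalised residual of \<open>s\<close> is put in front of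
  the list. Its coefficient in \<open>s\<close> is the norm of the residual, so the new sum restores
  \<open>s\<close>. It is orthogonal to every old \<open>bessel_sum\<close>, so vectors reproduced
  before remain so.\<close>

lemma orthonormal_extend:
  assumes "orthonormal es" "s \<in> carrier X"
  shows "\<exists>es'. orthonormal es' \<and> bessel_sum es' s = s \<and>
    {x \<in> carrier X. bessel_sum es x = x} \<subseteq> {x \<in> carrier X. bessel_sum es' x = x}"
proof (cases "bessel_sum es s = s")
  case True
  then show ?thesis using assms by blast
next
  case False
  have es: "set es \<subseteq> carrier X"
    using assms by (simp add: orthonormal_def)
  let ?p = "bessel_sum es s"
  define r where "r = vdiff s ?p"
  have p: "?p \<in> carrier X" and r: "r \<in> carrier X"
    using assms es by (auto simp: r_def bessel_sum_closed diff_closed)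
  have s: "vadd X r ?p = s"
    using assms p by (simp add: r_def diff_add_cancel)
  have "r \<noteq> vzero X"
    using s False p by (auto simp: zero_add)
  then have n: "vnorm X r > 0"
    using r norm_eq_0[of r] norm_nonneg[of r] by linarith
  define e where "e = vscale X (1 / vnorm X r) r"
  have e: "e \<in> carrier X"
    using r by (simp add: e_def scale_closed)
  have ee: "vinner X e e = 1"
    using r n by (simp add: e_def inner_scale_left inner_scale_right scale_closed inner_self[of r] power2_eq_square)
  have rb: "vinner X r b = 0" if "b \<in> set es" for b
  proof -
    have "b \<in> carrier X"
      using es that by auto
    then have "vinner X r b = vinner X s b - vinner X ?p b"
      using assms p by (simp add: r_def inner_add_left inner_scale_left scale_closed)
    then show ?thesis
      using inner_bessel_sum_orthonormal assms that by simp
  qed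
  have eb: "vinner X e b = 0" if "b \<in> set es" for b
    using rb[OF that] that r es by (auto simp: e_def inner_scale_left)
  have be: "vinner X b e = 0" if "b \<in> set es" for b
    using eb[OF that] inner_commute[of b e] e that es by auto
  have pe: "vinner X (bessel_sum es x) e = 0" for x
  proof -
    have "(\<Sum>b\<leftarrow>es. vinner X x b * vinner X b e) = 0"
      using be by (intro sum_list_eq_0) simp
    then show ?thesis
      using es e by (simp add: inner_bessel_sum)
  qed
  have "orthonormal (e # es)"
    using assms e ee eb by (simp add: orthonormal_def)
  moreover have "bessel_sum (e # es) s = s"
  proof -
    have "vinner X s e = vinner X r e"
      using arg_cong[OF s, of "\<lambda>v. vinner X v e"] r p e pe by (simp add: inner_add_left)
    also have "\<dots> = vnorm X r"
      using r n by (simp add: e_def inner_scale_right inner_self power2_eq_square)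
    finally have "vscale X (vinner X s e) e = r"
      using r n by (simp add: e_def scale_scale scale_one)
    then show ?thesis
      using s by simp
  qed
  moreover have "bessel_sum (e # es) x = x" if "x \<in> carrier X" "bessel_sum es x = x" for x
    using that pe[of x] e by (simp add: zero_add)
  ultimately show ?thesis by blast
qed

text \<open>Gram-Schmidt over a finite generating set gives a list reproducing all generators. The
  reproduced vectors form a subspace, hence include the span.\<close>

lemma finite_dimensional_bessel:
  assumes "finite_dimensional X"
  obtains es where "set es \<subseteq> carrier X" "\<And>x. x \<in> carrier X \<Longrightarrow> bessel_sum es x = x"
proof -
  obtain S where S: "finite S" "S \<subseteq> carrier X" "cspan X S = carrier X"
    using assms by (auto simp: finite_dimensional_def)
  have "\<exists>es. orthonormal es \<and> S \<subseteq> {x \<in> carrier X. bessel_sum es x = x}"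
    using S(1,2)
  proof (induction S rule: finite_induct)
    case empty
    show ?case by (rule exI[of _ "[]"]) (simp add: orthonormal_def)
  next
    case (insert s S)
    then obtain es where es: "orthonormal es" "S \<subseteq> {x \<in> carrier X. bessel_sum es x = x}"
      by auto
    then obtain es' where "orthonormal es'" "bessel_sum es' s = s"
      "{x \<in> carrier X. bessel_sum es x = x} \<subseteq> {x \<in> carrier X. bessel_sum es' x = x}"
      using orthonormal_extend[of es s] insert.prems by blast
    then show ?case
      using es insert.prems by (intro exI[of _ es']) blast
  qed
  then obtain es where es: "orthonormal es" "S \<subseteq> {x \<in> carrier X. bessel_sum es x = x}"
    by blast
  have "set es \<subseteq> carrier X"
    using es by (simp add: orthonormal_def)
  moreover from this have "cspan X S \<subseteq> {x \<in> carrier X. bessel_sum es x = x}"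
    using es(2) csubspace_bessel_fixed unfolding cspan_def by blast
  ultimately show ?thesis
    using that S(3) by blast
qed

text \<open>The reproducing formula for \<open>x\<close>, paired with \<open>x\<close>
  itself.\<close>

lemma parseval:
  assumes "set es \<subseteq> carrier X" "x \<in> carrier X" "bessel_sum es x = x"
  shows "(vnorm X x)\<^sup>2 = (\<Sum>e\<leftarrow>es. (cmod (vinner X x e))\<^sup>2)"
proof -
  have "vinner X x x = (\<Sum>e\<leftarrow>es. vinner X x e * vinner X e x)"
    using inner_bessel_sum[OF assms(1,2), of x] assms(3) by simp
  also have "\<dots> = (\<Sum>e\<leftarrow>es. complex_of_real ((cmod (vinner X x e))\<^sup>2))"
  proof (intro arg_cong[of _ _ sum_list] map_cong refl)
    fix e assume "e \<in> set es"
    then have "vinner X e x = cnj (vinner X x e)"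
      using assms inner_commute by blast
    then show "vinner X x e * vinner X e x = complex_of_real ((cmod (vinner X x e))\<^sup>2)"
      by (simp only: complex_norm_square)
  qed
  also have "\<dots> = complex_of_real (\<Sum>e\<leftarrow>es. (cmod (vinner X x e))\<^sup>2)"
    by (induction es) auto
  finally show ?thesis
    using inner_self[OF assms(2)] of_real_eq_iff by metis
qed

section \<open>Cauchy sequences and matrix coefficients in the completion\<close>

lemma cauchy_carrier: "vcauchy X s \<Longrightarrow> s n \<in> carrier X"
  by (simp add: vcauchy_def)

lemma cauchy_bounded:
  assumes "vcauchy X s"
  obtains M where "M > 0" "\<And>n. vnorm X (s n) \<le> M"
proof -
  obtain N where N: "\<And>m n. \<lbrakk>m \<ge> N; n \<ge> N\<rbrakk> \<Longrightarrow> vdist X (s m) (s n) < 1"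
    using assms by (metis vcauchy_def zero_less_one)
  define M where "M = 1 + (\<Sum>n\<le>N. vnorm X (s n))"
  have nn: "0 \<le> vnorm X (s n)" for n
    using assms cauchy_carrier by simp
  have le: "vnorm X (s n) \<le> (\<Sum>n\<le>N. vnorm X (s n))" if "n \<le> N" for n
    using that nn by (intro member_le_sum) auto
  have "vnorm X (s n) \<le> M" for n
  proof (cases "n \<le> N")
    case True
    then show ?thesis using le[of n] by (simp add: M_def)
  next
    case False
    then show ?thesis
      using N[of n N] le[of N] norm_le_dist[of "s n" "s N"] assms cauchy_carrier
      by (fastforce simp: M_def)
  qed
  moreover have "M > 0"
    unfolding M_def using nn by (simp add: add_pos_nonneg sum_nonneg)
  ultimately show ?thesis using that by blast
qed

lemma cauchy_class_self: "vcauchy X s \<Longrightarrow> s \<in> cauchy_class X s"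
  by (simp add: cauchy_class_def cauchy_carrier)

lemma cauchy_class_eqD:
  assumes "cauchy_class X s = cauchy_class X s'" "vcauchy X s'"
  shows "(\<lambda>n. vdist X (s n) (s' n)) \<longlonglongrightarrow> 0"
  using cauchy_class_self[OF assms(2)] assms(1) by (auto simp: cauchy_class_def)

lemma cauchy_class_subset:
  assumes "\<And>n. s n \<in> carrier X" "\<And>n. s' n \<in> carrier X" "(\<lambda>n. vdist X (s n) (s' n)) \<longlonglongrightarrow> 0"
  shows "cauchy_class X s \<subseteq> cauchy_class X s'"
proof
  fix u assume u: "u \<in> cauchy_class X s"
  then have c: "vcauchy X u" and lim: "(\<lambda>n. vdist X (s n) (u n)) \<longlonglongrightarrow> 0"
    by (auto simp: cauchy_class_def)
  have "(\<lambda>n. vdist X (s' n) (u n)) \<longlonglongrightarrow> 0"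
  proof (rule tendsto_sandwich[OF _ _ tendsto_const])
    show "\<forall>\<^sub>F n in sequentially. 0 \<le> vdist X (s' n) (u n)"
      using assms c cauchy_carrier by (intro always_eventually allI dist_nonneg) auto
    show "\<forall>\<^sub>F n in sequentially. vdist X (s' n) (u n) \<le> vdist X (s n) (s' n) + vdist X (s n) (u n)"
      using dist_triangle[of "s' _" "s _" "u _"] dist_commute[of "s _" "s' _"] assms cauchy_carrier[OF c]
      by (intro always_eventually allI) simp
    show "(\<lambda>n. vdist X (s n) (s' n) + vdist X (s n) (u n)) \<longlonglongrightarrow> 0"
      using tendsto_add[OF assms(3) lim] by simp
  qed
  then show "u \<in> cauchy_class X s'"
    using c by (simp add: cauchy_class_def)
qed

lemma cauchy_class_eqI:
  assumes "\<And>n. s n \<in> carrier X" "\<And>n. s' n \<in> carrier X" "(\<lambda>n. vdist X (s n) (s' n)) \<longlonglongrightarrow> 0"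
  shows "cauchy_class X s = cauchy_class X s'"
proof -
  have "(\<lambda>n. vdist X (s' n) (s n)) \<longlonglongrightarrow> 0"
    using assms dist_commute[of "s' _" "s _"] by simp
  then show ?thesis
    using assms cauchy_class_subset[of s s'] cauchy_class_subset[of s' s] by blast
qed

text \<open>The estimate involves only norms and distances, which every \<open>T\<close> in the
  family preserves, so one index \<open>N\<close> serves the whole family. The quantity
  \<open>d\<close> splits \<open>e\<close> in proportion to the bounds \<open>M\<close> and
  \<open>M'\<close> of the two sequences.\<close>

lemma inner_cauchy:
  assumes "vcauchy X s" "vcauchy X s'" "e > 0"
    and "\<And>T x. \<lbrakk>T \<in> \<T>; x \<in> carrier X\<rbrakk> \<Longrightarrow> T x \<in> carrier X"
    and "\<And>T x. \<lbrakk>T \<in> \<T>; x \<in> carrier X\<rbrakk> \<Longrightarrow> vnorm X (T x) = vnorm X x"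
    and "\<And>T x y. \<lbrakk>T \<in> \<T>; x \<in> carrier X; y \<in> carrier X\<rbrakk> \<Longrightarrow> vdist X (T x) (T y) = vdist X x y"
  obtains N where "\<And>T m n. \<lbrakk>T \<in> \<T>; m \<ge> N; n \<ge> N\<rbrakk>
    \<Longrightarrow> cmod (vinner X (T (s m)) (s' m) - vinner X (T (s n)) (s' n)) < e"
proof -
  obtain M where M: "M > 0" "\<And>n. vnorm X (s n) \<le> M"
    using cauchy_bounded assms(1) by blast
  obtain M' where M': "M' > 0" "\<And>n. vnorm X (s' n) \<le> M'"
    using cauchy_bounded assms(2) by blast
  define d where "d = e / (M + M')"
  have d: "d > 0"
    using M M' assms(3) by (simp add: d_def)
  have "d * M' + M * d = d * (M + M')"
    by (simp add: algebra_simps)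
  then have e: "d * M' + M * d = e"
    using M M' by (simp add: d_def)
  obtain N where N: "\<And>m n. \<lbrakk>m \<ge> N; n \<ge> N\<rbrakk> \<Longrightarrow> vdist X (s m) (s n) < d"
    using assms(1) d by (metis vcauchy_def)
  obtain N' where N': "\<And>m n. \<lbrakk>m \<ge> N'; n \<ge> N'\<rbrakk> \<Longrightarrow> vdist X (s' m) (s' n) < d"
    using assms(2) d by (metis vcauchy_def)
  have c: "s n \<in> carrier X" "s' n \<in> carrier X" for n
    using assms(1,2) cauchy_carrier by auto
  show ?thesis
  proof (rule that[of "max N N'"])
    fix T m n assume T: "T \<in> \<T>" and mn: "m \<ge> max N N'" "n \<ge> max N N'"
    have "cmod (vinner X (T (s m)) (s' m) - vinner X (T (s n)) (s' n))
        \<le> vdist X (s m) (s n) * vnorm X (s' m) + vnorm X (s n) * vdist X (s' m) (s' n)"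
      using inner_perturb[of "T (s m)" "s' m" "T (s n)" "s' n"] T c assms(4-6) by simp
    also have "\<dots> < d * M' + M * d"
    proof (rule add_le_less_mono)
      show "vdist X (s m) (s n) * vnorm X (s' m) \<le> d * M'"
        using N[of m n] mn M' c d by (intro mult_mono) auto
      have "vnorm X (s n) * vdist X (s' m) (s' n) \<le> M * vdist X (s' m) (s' n)"
        using M c by (intro mult_right_mono) auto
      also have "\<dots> < M * d"
        using N'[of m n] mn M by simp
      finally show "vnorm X (s n) * vdist X (s' m) (s' n) < M * d" .
    qed
    finally show "cmod (vinner X (T (s m)) (s' m) - vinner X (T (s n)) (s' n)) < e"
      using e by simp
  qed
qed

text \<open>The inner products form a Cauchy sequence, and replacing the representatives by
  equivalent ones changes them by a null sequence. The description in \<open>completion\<close>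
  therefore denotes their limit.\<close>

lemma inner_completion:
  assumes "vcauchy X s" "vcauchy X s'"
  shows "(\<lambda>n. vinner X (s n) (s' n)) \<longlonglongrightarrow> vinner (completion X) (cauchy_class X s) (cauchy_class X s')"
proof -
  have c: "s n \<in> carrier X" "s' n \<in> carrier X" for n
    using assms cauchy_carrier by auto
  have "Cauchy (\<lambda>n. vinner X (s n) (s' n))"
  proof (rule CauchyI)
    fix e :: real assume "e > 0"
    then obtain N where "\<And>T m n. \<lbrakk>T \<in> {id}; m \<ge> N; n \<ge> N\<rbrakk>
        \<Longrightarrow> cmod (vinner X (T (s m)) (s' m) - vinner X (T (s n)) (s' n)) < e"
      by (rule inner_cauchy[OF assms, of e "{id}"]) auto
    then show "\<exists>N. \<forall>m\<ge>N. \<forall>n\<ge>N. cmod (vinner X (s m) (s' m) - vinner X (s n) (s' n)) < e"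
      by (intro exI[of _ N]) simp
  qed
  then obtain l where l: "(\<lambda>n. vinner X (s n) (s' n)) \<longlonglongrightarrow> l"
    using Cauchy_convergent convergentD by blast
  have "vinner (completion X) (cauchy_class X s) (cauchy_class X s') = l"
    unfolding completion_def cspace.simps
  proof (rule the_equality)
    show "\<exists>u u'. vcauchy X u \<and> vcauchy X u' \<and> cauchy_class X s = cauchy_class X u \<and>
        cauchy_class X s' = cauchy_class X u' \<and> (\<lambda>n. vinner X (u n) (u' n)) \<longlonglongrightarrow> l"
      using assms l by blast
  next
    fix k assume "\<exists>u u'. vcauchy X u \<and> vcauchy X u' \<and> cauchy_class X s = cauchy_class X u \<and>
        cauchy_class X s' = cauchy_class X u' \<and> (\<lambda>n. vinner X (u n) (u' n)) \<longlonglongrightarrow> k"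
    then obtain u u' where u: "vcauchy X u" "vcauchy X u'" "cauchy_class X s = cauchy_class X u"
        "cauchy_class X s' = cauchy_class X u'" "(\<lambda>n. vinner X (u n) (u' n)) \<longlonglongrightarrow> k"
      by blast
    have cu: "u n \<in> carrier X" "u' n \<in> carrier X" for n
      using u cauchy_carrier by auto
    obtain M where M: "M > 0" "\<And>n. vnorm X (s' n) \<le> M"
      using cauchy_bounded assms(2) by blast
    obtain M' where M': "M' > 0" "\<And>n. vnorm X (u n) \<le> M'"
      using cauchy_bounded u(1) by blast
    have "(\<lambda>n. vinner X (s n) (s' n) - vinner X (u n) (u' n)) \<longlonglongrightarrow> 0"
    proof (rule tendsto_0_le)
      show "(\<lambda>n. vdist X (s n) (u n) * M + M' * vdist X (s' n) (u' n)) \<longlonglongrightarrow> 0"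
        using tendsto_add[OF tendsto_mult_left_zero[OF cauchy_class_eqD[OF u(3,1)], of M]
            tendsto_mult_right_zero[OF cauchy_class_eqD[OF u(4,2)], of M']] by simp
      show "\<forall>\<^sub>F n in sequentially. cmod (vinner X (s n) (s' n) - vinner X (u n) (u' n))
          \<le> norm (vdist X (s n) (u n) * M + M' * vdist X (s' n) (u' n)) * 1"
      proof (intro always_eventually allI)
        fix n
        have "cmod (vinner X (s n) (s' n) - vinner X (u n) (u' n))
          \<le> vdist X (s n) (u n) * vnorm X (s' n) + vnorm X (u n) * vdist X (s' n) (u' n)"
          using c cu by (intro inner_perturb)
        also have "\<dots> \<le> vdist X (s n) (u n) * M + M' * vdist X (s' n) (u' n)"
          using M M' c cu by (intro add_mono mult_left_mono mult_right_mono) auto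
        finally show "cmod (vinner X (s n) (s' n) - vinner X (u n) (u' n))
          \<le> norm (vdist X (s n) (u n) * M + M' * vdist X (s' n) (u' n)) * 1"
          by simp
      qed
    qed
    then have "(\<lambda>n. vinner X (s n) (s' n) - (vinner X (s n) (s' n) - vinner X (u n) (u' n))) \<longlonglongrightarrow> l - 0"
      using l by (intro tendsto_diff)
    then have "(\<lambda>n. vinner X (u n) (u' n)) \<longlonglongrightarrow> l"
      by simp
    then show "k = l"
      using u(5) LIMSEQ_unique by blast
  qed
  then show ?thesis using l by simp
qed

lemma completion_map_class:
  assumes "vcauchy X s" "\<And>x. x \<in> carrier X \<Longrightarrow> T x \<in> carrier X"
    and "\<And>x y. \<lbrakk>x \<in> carrier X; y \<in> carrier X\<rbrakk> \<Longrightarrow> vdist X (T x) (T y) = vdist X x y"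
  shows "completion_map X T (cauchy_class X s) = cauchy_class X (\<lambda>n. T (s n))"
  unfolding completion_map_def
proof (rule the_equality)
  show "\<exists>u. vcauchy X u \<and> cauchy_class X s = cauchy_class X u \<and>
      cauchy_class X (\<lambda>n. T (s n)) = cauchy_class X (\<lambda>n. T (u n))"
    using assms(1) by blast
next
  fix r assume "\<exists>u. vcauchy X u \<and> cauchy_class X s = cauchy_class X u \<and> r = cauchy_class X (\<lambda>n. T (u n))"
  then obtain u where u: "vcauchy X u" "cauchy_class X s = cauchy_class X u"
      "r = cauchy_class X (\<lambda>n. T (u n))"
    by blast
  have "cauchy_class X (\<lambda>n. T (s n)) = cauchy_class X (\<lambda>n. T (u n))"
    using cauchy_class_eqD[OF u(2,1)] assms u(1) cauchy_carrier by (intro cauchy_class_eqI) auto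
  then show "r = cauchy_class X (\<lambda>n. T (s n))"
    using u by simp
qed

text \<open>Letting \<open>m\<close> tend to infinity in \<open>inner_cauchy\<close> with
  \<open>n\<close> fixed gives a bound whose threshold for \<open>n\<close> is independent of
  \<open>T\<close>. The form with \<open>eventually\<close> lets finitely many pairs of vectors
  share one \<open>n\<close>.\<close>

lemma completion_coefficient_approx:
  assumes "vcauchy X s" "vcauchy X s'" "e > 0"
    and closed: "\<And>T x. \<lbrakk>T \<in> \<T>; x \<in> carrier X\<rbrakk> \<Longrightarrow> T x \<in> carrier X"
    and norm: "\<And>T x. \<lbrakk>T \<in> \<T>; x \<in> carrier X\<rbrakk> \<Longrightarrow> vnorm X (T x) = vnorm X x"
    and dist: "\<And>T x y. \<lbrakk>T \<in> \<T>; x \<in> carrier X; y \<in> carrier X\<rbrakk> \<Longrightarrow> vdist X (T x) (T y) = vdist X x y"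
  shows "\<forall>\<^sub>F n in sequentially. \<forall>T\<in>\<T>.
    cmod (vinner (completion X) (completion_map X T (cauchy_class X s)) (cauchy_class X s')
      - vinner X (T (s n)) (s' n)) \<le> e"
proof -
  obtain N where N: "\<And>T m n. \<lbrakk>T \<in> \<T>; m \<ge> N; n \<ge> N\<rbrakk>
      \<Longrightarrow> cmod (vinner X (T (s m)) (s' m) - vinner X (T (s n)) (s' n)) < e"
    by (rule inner_cauchy[OF assms(1-3), of \<T>]) (use closed norm dist in auto)
  have "cmod (vinner (completion X) (completion_map X T (cauchy_class X s)) (cauchy_class X s')
      - vinner X (T (s n)) (s' n)) \<le> e" if "n \<ge> N" "T \<in> \<T>" for n T
  proof -
    have "vcauchy X (\<lambda>n. T (s n))"
      using assms(1) closed dist that(2) by (auto simp: vcauchy_def)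
    then have "(\<lambda>m. vinner X (T (s m)) (s' m)) \<longlonglongrightarrow>
        vinner (completion X) (completion_map X T (cauchy_class X s)) (cauchy_class X s')"
      using inner_completion[OF _ assms(2)] completion_map_class[OF assms(1), of T] closed dist that(2)
      by simp
    then have "(\<lambda>m. cmod (vinner X (T (s m)) (s' m) - vinner X (T (s n)) (s' n))) \<longlonglongrightarrow>
        cmod (vinner (completion X) (completion_map X T (cauchy_class X s)) (cauchy_class X s')
          - vinner X (T (s n)) (s' n))"
      by (intro tendsto_intros)
    moreover have "\<forall>\<^sub>F m in sequentially. cmod (vinner X (T (s m)) (s' m) - vinner X (T (s n)) (s' n)) \<le> e"
      using N that by (intro eventually_sequentiallyI[of N]) (simp add: less_imp_le)
    ultimately show ?thesis
      by (rule tendsto_upperbound) simp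
  qed
  then show ?thesis
    by (intro eventually_sequentiallyI[of N]) auto
qed

end

section \<open>The direct limit of the decorated trees\<close>

locale pythagorean = pre_hilbert_space H for H :: "'h cspace" +
  fixes A B :: "'h \<Rightarrow> 'h"
  assumes pair: "pythagorean_pair H A B"
begin

lemma AB_linear: "linear_map H H A" "linear_map H H B"
  using pair by (auto simp: pythagorean_pair_def bounded_operator_def)

lemma AB_closed [simp]: "x \<in> carrier H \<Longrightarrow> A x \<in> carrier H" "x \<in> carrier H \<Longrightarrow> B x \<in> carrier H"
  using AB_linear by (auto simp: linear_map_def)

lemma AB_add:
  assumes "x \<in> carrier H" "y \<in> carrier H"
  shows "A (vadd H x y) = vadd H (A x) (A y)" "B (vadd H x y) = vadd H (B x) (B y)"
  using AB_linear assms by (auto simp: linear_map_def)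

lemma AB_scale:
  assumes "x \<in> carrier H"
  shows "A (vscale H c x) = vscale H c (A x)" "B (vscale H c x) = vscale H c (B x)"
  using AB_linear assms by (auto simp: linear_map_def)

text \<open>The identity \<open>A' A + B' B = 1\<close>, paired with \<open>x\<close>. It says that
  splitting a leaf preserves inner products.\<close>

lemma AB_inner:
  assumes "x \<in> carrier H" "y \<in> carrier H"
  shows "vinner H (A x) (A y) + vinner H (B x) (B y) = vinner H x y"
proof -
  obtain A' B' where adj: "is_adjoint H A A'" "is_adjoint H B B'"
    and id: "\<And>z. z \<in> carrier H \<Longrightarrow> vadd H (A' (A z)) (B' (B z)) = z"
    using pair by (auto simp: pythagorean_pair_def)
  have "A' (A y) \<in> carrier H" "B' (B y) \<in> carrier H"
    using adj assms by (auto simp: is_adjoint_def bounded_operator_def linear_map_def)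
  then show ?thesis
    using adj assms id[OF assms(2)] by (simp add: is_adjoint_def flip: inner_add_right)
qed

lemma AB_inj: "\<lbrakk>x \<in> carrier H; y \<in> carrier H; A x = A y; B x = B y\<rbrakk> \<Longrightarrow> x = y"
  using pair unfolding pythagorean_pair_def by metis

lemma Phi_tree_closed: "x \<in> carrier H \<Longrightarrow> set (Phi_tree A B t x) \<subseteq> carrier H"
  by (induction t arbitrary: x) auto

lemma length_Phi: "length f = length xs \<Longrightarrow> length (Phi A B f xs) = sum_list (map leaves f)"
  by (induction f xs rule: list_induct2) auto

lemma Phi_closed: "\<lbrakk>length f = length xs; set xs \<subseteq> carrier H\<rbrakk> \<Longrightarrow> set (Phi A B f xs) \<subseteq> carrier H"
proof (induction f xs rule: list_induct2)
  case (Cons t f x xs)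
  then show ?case using Phi_tree_closed[of x t] by simp
qed simp

lemma Phi_tree_inj:
  "\<lbrakk>x \<in> carrier H; y \<in> carrier H; Phi_tree A B t x = Phi_tree A B t y\<rbrakk> \<Longrightarrow> x = y"
proof (induction t arbitrary: x y)
  case Leaf
  then show ?case by simp
next
  case (Node l r)
  then have "A x = A y" "B x = B y"
    by (auto simp: append_eq_append_conv)
  then show ?case using AB_inj Node.prems by blast
qed

lemma Phi_inj:
  assumes "length f = length xs" "length xs = length ys" "set xs \<subseteq> carrier H" "set ys \<subseteq> carrier H"
    "Phi A B f xs = Phi A B f ys"
  shows "xs = ys"
  using assms
proof (induction f xs ys rule: list_induct3)
  case (Cons t f x xs y ys)
  then show ?case
    using Phi_tree_inj[of x y t] by (simp add: append_eq_append_conv)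
qed simp

section \<open>The inner product of decorations\<close>

definition list_inner :: "'h list \<Rightarrow> 'h list \<Rightarrow> complex" where
  "list_inner xs ys = sum_list (map2 (vinner H) xs ys)"

lemma list_inner_simps [simp]:
  "list_inner [] [] = 0" "list_inner (x # xs) (y # ys) = vinner H x y + list_inner xs ys"
  by (auto simp: list_inner_def)

lemma list_inner_append:
  "length xs = length ys \<Longrightarrow> list_inner (xs @ xs') (ys @ ys') = list_inner xs ys + list_inner xs' ys'"
  by (simp add: list_inner_def)

lemma list_inner_eq_sum:
  "length xs = length ys \<Longrightarrow> (\<Sum>i<length xs. vinner H (xs ! i) (ys ! i)) = list_inner xs ys"
  by (induction xs ys rule: list_induct2) (simp_all add: sum.lessThan_Suc_shift del: sum.lessThan_Suc)

lemma list_inner_Phi_tree: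
  "\<lbrakk>x \<in> carrier H; y \<in> carrier H\<rbrakk>
     \<Longrightarrow> list_inner (Phi_tree A B t x) (Phi_tree A B t y) = vinner H x y"
  by (induction t arbitrary: x y) (simp_all add: list_inner_append AB_inner)

lemma list_inner_Phi:
  assumes "length f = length xs" "length xs = length ys" "set xs \<subseteq> carrier H" "set ys \<subseteq> carrier H"
  shows "list_inner (Phi A B f xs) (Phi A B f ys) = list_inner xs ys"
  using assms
  by (induction f xs ys rule: list_induct3) (simp_all add: list_inner_append list_inner_Phi_tree)

lemma Phi_tree_add:
  "\<lbrakk>x \<in> carrier H; y \<in> carrier H\<rbrakk>
     \<Longrightarrow> Phi_tree A B t (vadd H x y) = map2 (vadd H) (Phi_tree A B t x) (Phi_tree A B t y)"
  by (induction t arbitrary: x y) (simp_all add: AB_add)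

lemma Phi_add:
  assumes "length f = length xs" "length xs = length ys" "set xs \<subseteq> carrier H" "set ys \<subseteq> carrier H"
  shows "Phi A B f (map2 (vadd H) xs ys) = map2 (vadd H) (Phi A B f xs) (Phi A B f ys)"
  using assms by (induction f xs ys rule: list_induct3) (simp_all add: Phi_tree_add)

lemma Phi_tree_scale:
  "x \<in> carrier H \<Longrightarrow> Phi_tree A B t (vscale H c x) = map (vscale H c) (Phi_tree A B t x)"
  by (induction t arbitrary: x) (simp_all add: AB_scale)

lemma Phi_scale:
  assumes "length f = length xs" "set xs \<subseteq> carrier H"
  shows "Phi A B f (map (vscale H c) xs) = map (vscale H c) (Phi A B f xs)"
  using assms by (induction f xs rule: list_induct2) (simp_all add: Phi_tree_scale)

lemma AB_zero: "A (vzero H) = vzero H" "B (vzero H) = vzero H"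
  using AB_scale[OF zero_closed, of 0] zero_closed by simp_all

lemma Phi_tree_zero: "Phi_tree A B t (vzero H) = replicate (leaves t) (vzero H)"
  by (induction t) (simp_all add: AB_zero replicate_add)

text \<open>Injectivity is where the Pythagorean relation enters: a vector is recovered from its two
  children, hence a decoration from any of its refinements.\<close>

sublocale dec: forest_action "\<lambda>n. {\<xi>. length \<xi> = n \<and> set \<xi> \<subseteq> carrier H}" "Phi A B"
proof
  show "Phi A B f x \<in> {\<xi>. length \<xi> = sum_list (map leaves f) \<and> set \<xi> \<subseteq> carrier H}"
    if "x \<in> {\<xi>. length \<xi> = length f \<and> set \<xi> \<subseteq> carrier H}" for x f
    using that length_Phi[of f x] Phi_closed[of f x] by simp
  show "Phi A B (forest_compose f g) x = Phi A B f (Phi A B g x)"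
    if "x \<in> {\<xi>. length \<xi> = length g \<and> set \<xi> \<subseteq> carrier H}" "length f = sum_list (map leaves g)" for x f g
    using that by (simp add: Phi_compose)
  show "Phi A B (replicate n Leaf) x = x" if "x \<in> {\<xi>. length \<xi> = n \<and> set \<xi> \<subseteq> carrier H}" for x n
    using that Phi_replicate_Leaf[of A B x] by simp
  show "x = y" if "x \<in> {\<xi>. length \<xi> = length f \<and> set \<xi> \<subseteq> carrier H}"
    "y \<in> {\<xi>. length \<xi> = length f \<and> set \<xi> \<subseteq> carrier H}" "Phi A B f x = Phi A B f y" for x y f
    using that Phi_inj[of f x y] by simp
qed

section \<open>The direct limit as a pre-Hilbert space\<close>

abbreviation K_space :: "(tree \<times> 'h list) set cspace" where
  "K_space \<equiv> dec_limit H A B"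

abbreviation dc :: "tree \<Rightarrow> 'h list \<Rightarrow> (tree \<times> 'h list) set" where
  "dc \<equiv> dec_class H A B"

lemma decorations_iff: "\<xi> \<in> decorations H t \<longleftrightarrow> length \<xi> = leaves t \<and> set \<xi> \<subseteq> carrier H"
  by (simp add: decorations_def)

lemma decorations_eq: "decorations H t = {\<xi>. length \<xi> = leaves t \<and> set \<xi> \<subseteq> carrier H}"
  by (simp add: decorations_def)

lemma dec_step_eq: "dec_step H A B = dec.step"
  by (auto simp: fun_eq_iff dec_step.simps dec.step.simps decorations_def)

lemma dec_class_eq: "dc = dec.cls"
  by (simp add: fun_eq_iff dec_class_def dec.cls_def dec_step_eq)

lemmas dec_class_graft = dec.cls_graft[folded decorations_eq dec_class_eq]
  and dec_class_eqD = dec.cls_eqD[folded decorations_eq dec_class_eq]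
  and dec_class_common_finite = dec.cls_common_finite[folded decorations_eq dec_class_eq]
  and dec_action_well_defined = dec.action_well_defined[folded decorations_eq dec_class_eq]

lemma carrier_K_space: "carrier K_space = {dc t \<xi> |t \<xi>. \<xi> \<in> decorations H t}"
  by (simp add: dec_limit_def)

lemma dec_class_closed [simp]: "\<xi> \<in> decorations H t \<Longrightarrow> dc t \<xi> \<in> carrier K_space"
  by (auto simp: carrier_K_space)

lemma common_tree:
  assumes "finite Z" "Z \<subseteq> carrier K_space"
  obtains u \<xi> where "\<And>z. z \<in> Z \<Longrightarrow> \<xi> z \<in> decorations H u" "\<And>z. z \<in> Z \<Longrightarrow> z = dc u (\<xi> z)"
proof -
  obtain u where "\<forall>z\<in>Z. \<exists>x\<in>decorations H u. z = dc u x"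
    using dec_class_common_finite[of Z] assms unfolding carrier_K_space by blast
  then obtain \<xi> where "\<forall>z\<in>Z. \<xi> z \<in> decorations H u \<and> z = dc u (\<xi> z)"
    by metis
  then show ?thesis using that by blast
qed

lemma map2_add_dec:
  "\<lbrakk>\<xi> \<in> decorations H t; \<eta> \<in> decorations H t\<rbrakk> \<Longrightarrow> map2 (vadd H) \<xi> \<eta> \<in> decorations H t"
  by (fastforce simp: decorations_iff set_zip intro!: add_closed)

lemma map_scale_dec: "\<xi> \<in> decorations H t \<Longrightarrow> map (vscale H c) \<xi> \<in> decorations H t"
  by (auto simp: decorations_iff scale_closed)

text \<open>Any other representatives allowed by the descriptions in \<open>dec_limit\<close> become
  equal to the given ones over a common refinement. There the results agree because
  \<open>Phi\<close> is linear and preserves \<open>list_inner\<close>.\<close>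

lemma K_space_ops:
  assumes "\<xi> \<in> decorations H t" "\<eta> \<in> decorations H t"
  shows K_space_add: "vadd K_space (dc t \<xi>) (dc t \<eta>) = dc t (map2 (vadd H) \<xi> \<eta>)"
    and K_space_scale: "vscale K_space c (dc t \<xi>) = dc t (map (vscale H c) \<xi>)"
    and K_space_inner: "vinner K_space (dc t \<xi>) (dc t \<eta>) = list_inner \<xi> \<eta>"
proof -
  show "vadd K_space (dc t \<xi>) (dc t \<eta>) = dc t (map2 (vadd H) \<xi> \<eta>)"
    unfolding dec_limit_def cspace.simps
  proof (rule the_equality)
    fix v assume "\<exists>s \<alpha> \<beta>. \<alpha> \<in> decorations H s \<and> \<beta> \<in> decorations H s \<and>
        dc t \<xi> = dc s \<alpha> \<and> dc t \<eta> = dc s \<beta> \<and> v = dc s (map2 (vadd H) \<alpha> \<beta>)"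
    then obtain s \<alpha> \<beta> where s: "\<alpha> \<in> decorations H s" "\<beta> \<in> decorations H s"
        "dc t \<xi> = dc s \<alpha>" "dc t \<eta> = dc s \<beta>" "v = dc s (map2 (vadd H) \<alpha> \<beta>)"
      by blast
    obtain f g where fg: "length f = leaves t" "length g = leaves s" "graft f t = graft g s"
      using common_refinement by blast
    have e: "Phi A B f \<xi> = Phi A B g \<alpha>" "Phi A B f \<eta> = Phi A B g \<beta>"
      using dec_class_eqD[OF s(3) fg] dec_class_eqD[OF s(4) fg] assms s by auto
    have "Phi A B f (map2 (vadd H) \<xi> \<eta>) = Phi A B g (map2 (vadd H) \<alpha> \<beta>)"
      using e assms s(1,2) fg by (simp add: Phi_add decorations_iff)
    then show "v = dc t (map2 (vadd H) \<xi> \<eta>)"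
      using dec_class_graft[OF map2_add_dec[OF assms] fg(1)] dec_class_graft[OF map2_add_dec[OF s(1,2)] fg(2)]
        fg(3) s(5) by metis
  qed (use assms in blast)
  show "vscale K_space c (dc t \<xi>) = dc t (map (vscale H c) \<xi>)"
    unfolding dec_limit_def cspace.simps
  proof (rule the_equality)
    fix v assume "\<exists>s \<alpha>. \<alpha> \<in> decorations H s \<and> dc t \<xi> = dc s \<alpha> \<and> v = dc s (map (vscale H c) \<alpha>)"
    then obtain s \<alpha> where s: "\<alpha> \<in> decorations H s" "dc t \<xi> = dc s \<alpha>" "v = dc s (map (vscale H c) \<alpha>)"
      by blast
    obtain f g where fg: "length f = leaves t" "length g = leaves s" "graft f t = graft g s"
      using common_refinement by blast
    have e: "Phi A B f \<xi> = Phi A B g \<alpha>"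
      using dec_class_eqD[OF s(2) fg] assms s by auto
    have "Phi A B f (map (vscale H c) \<xi>) = Phi A B g (map (vscale H c) \<alpha>)"
      using e assms s(1) fg by (simp add: Phi_scale decorations_iff)
    then show "v = dc t (map (vscale H c) \<xi>)"
      using dec_class_graft[OF map_scale_dec[OF assms(1)] fg(1)] dec_class_graft[OF map_scale_dec[OF s(1)] fg(2)]
        fg(3) s(3) by metis
  qed (use assms in blast)
  have sum: "(\<Sum>i<leaves s. vinner H (\<alpha> ! i) (\<beta> ! i)) = list_inner \<alpha> \<beta>"
    if "\<alpha> \<in> decorations H s" "\<beta> \<in> decorations H s" for \<alpha> \<beta> s
    using that list_inner_eq_sum[of \<alpha> \<beta>] by (simp add: decorations_iff)
  show "vinner K_space (dc t \<xi>) (dc t \<eta>) = list_inner \<xi> \<eta>"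
    unfolding dec_limit_def cspace.simps
  proof (rule the_equality)
    show "\<exists>s \<alpha> \<beta>. \<alpha> \<in> decorations H s \<and> \<beta> \<in> decorations H s \<and> dc t \<xi> = dc s \<alpha> \<and>
        dc t \<eta> = dc s \<beta> \<and> list_inner \<xi> \<eta> = (\<Sum>i<leaves s. vinner H (\<alpha> ! i) (\<beta> ! i))"
      using assms sum[OF assms] by metis
  next
    fix v assume "\<exists>s \<alpha> \<beta>. \<alpha> \<in> decorations H s \<and> \<beta> \<in> decorations H s \<and> dc t \<xi> = dc s \<alpha> \<and>
        dc t \<eta> = dc s \<beta> \<and> v = (\<Sum>i<leaves s. vinner H (\<alpha> ! i) (\<beta> ! i))"
    then obtain s \<alpha> \<beta> where s: "\<alpha> \<in> decorations H s" "\<beta> \<in> decorations H s"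
        "dc t \<xi> = dc s \<alpha>" "dc t \<eta> = dc s \<beta>" "v = (\<Sum>i<leaves s. vinner H (\<alpha> ! i) (\<beta> ! i))"
      by blast
    obtain f g where fg: "length f = leaves t" "length g = leaves s" "graft f t = graft g s"
      using common_refinement by blast
    have "Phi A B f \<xi> = Phi A B g \<alpha>" "Phi A B f \<eta> = Phi A B g \<beta>"
      using dec_class_eqD[OF s(3) fg] dec_class_eqD[OF s(4) fg] assms s by auto
    moreover have "list_inner (Phi A B f \<xi>) (Phi A B f \<eta>) = list_inner \<xi> \<eta>"
      "list_inner (Phi A B g \<alpha>) (Phi A B g \<beta>) = list_inner \<alpha> \<beta>"
      using assms s(1,2) fg by (auto simp: decorations_iff intro!: list_inner_Phi)
    ultimately show "v = list_inner \<xi> \<eta>"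
      using sum[OF s(1,2)] s(5) by simp
  qed
qed

text \<open>The zero vector is defined on the trivial tree; this form allows it to share a tree with
  other vectors.\<close>

lemma K_space_zero: "vzero K_space = dc t (replicate (leaves t) (vzero H))"
  using dec_class_graft[of "[vzero H]" Leaf "[t]"]
  by (simp add: dec_limit_def decorations_iff zero_closed Phi_tree_zero)

lemma replicate_zero_dec: "replicate (leaves t) (vzero H) \<in> decorations H t"
  by (auto simp: decorations_iff zero_closed)

lemma list_inner_self_pos:
  assumes "set xs \<subseteq> carrier H"
  shows "0 \<le> Re (list_inner xs xs)"
    and "xs \<noteq> replicate (length xs) (vzero H) \<Longrightarrow> 0 < Re (list_inner xs xs)"
proof -
  have *: "0 \<le> Re (list_inner xs xs) \<and> (xs \<noteq> replicate (length xs) (vzero H) \<longrightarrow> 0 < Re (list_inner xs xs))"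
    using assms
  proof (induction xs)
    case (Cons x xs)
    then show ?case
      using inner_pos[of x] Re_inner_self_nonneg[of x] by (auto intro: add_nonneg_pos add_pos_nonneg)
  qed simp
  show "0 \<le> Re (list_inner xs xs)"
    and "xs \<noteq> replicate (length xs) (vzero H) \<Longrightarrow> 0 < Re (list_inner xs xs)"
    using * by blast+
qed

lemma list_inner_commute:
  assumes "length xs = length ys" "set xs \<subseteq> carrier H" "set ys \<subseteq> carrier H"
  shows "list_inner xs ys = cnj (list_inner ys xs)"
  using assms by (induction xs ys rule: list_induct2) (auto intro: inner_commute)

lemma list_inner_add:
  assumes "length xs = length ys" "length ys = length zs"
    and "set xs \<subseteq> carrier H" "set ys \<subseteq> carrier H" "set zs \<subseteq> carrier H"
  shows "list_inner (map2 (vadd H) xs ys) zs = list_inner xs zs + list_inner ys zs"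
  using assms by (induction xs ys zs rule: list_induct3) (auto simp: inner_add_left)

lemma list_inner_scale:
  assumes "length xs = length ys" "set xs \<subseteq> carrier H" "set ys \<subseteq> carrier H"
  shows "list_inner (map (vscale H c) xs) ys = c * list_inner xs ys"
  using assms by (induction xs ys rule: list_induct2) (auto simp: inner_scale_left algebra_simps)

lemma nth_dec: "\<lbrakk>\<xi> \<in> decorations H t; i < leaves t\<rbrakk> \<Longrightarrow> \<xi> ! i \<in> carrier H"
  by (auto simp: decorations_iff subset_iff)

lemma set_dec: "\<xi> \<in> decorations H t \<Longrightarrow> set \<xi> \<subseteq> carrier H"
  by (simp add: decorations_iff)

lemma length_dec: "\<xi> \<in> decorations H t \<Longrightarrow> length \<xi> = leaves t"
  by (simp add: decorations_iff)

sublocale Ks: pre_hilbert_space K_space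
proof
  note simps = K_space_add K_space_scale K_space_inner map2_add_dec map_scale_dec
  \<comment> \<open>No axiom involves more than three vectors. Over one common tree each of them
    becomes a statement about lists, checked entry by entry.\<close>
  have rep: "\<exists>t \<xi> \<eta> \<zeta>. \<xi> \<in> decorations H t \<and> \<eta> \<in> decorations H t \<and> \<zeta> \<in> decorations H t \<and>
      x = dc t \<xi> \<and> y = dc t \<eta> \<and> z = dc t \<zeta>"
    if "x \<in> carrier K_space" "y \<in> carrier K_space" "z \<in> carrier K_space" for x y z
    using common_tree[of "{x, y, z}"] that by (metis empty_subsetI finite.intros insert_iff insert_subset)
  show "vzero K_space \<in> carrier K_space"
    using K_space_zero[of Leaf] replicate_zero_dec[of Leaf] by simp
  fix x assume x: "x \<in> carrier K_space"
  obtain t \<xi> where \<xi>: "\<xi> \<in> decorations H t" "x = dc t \<xi>"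
    using rep[OF x x x] by blast
  show "vscale K_space c x \<in> carrier K_space" for c
    using \<xi> by (simp add: simps)
  show "vadd K_space x (vzero K_space) = x"
  proof -
    have "map2 (vadd H) \<xi> (replicate (leaves t) (vzero H)) = \<xi>"
      using \<xi> by (auto simp: list_eq_iff_nth_eq nth_dec length_dec add_zero)
    then show ?thesis
      using \<xi> K_space_add[OF \<xi>(1) replicate_zero_dec] by (simp add: K_space_zero[of t])
  qed
  show "\<exists>y\<in>carrier K_space. vadd K_space x y = vzero K_space"
  proof
    have "map2 (vadd H) \<xi> (map (vscale H (-1)) \<xi>) = replicate (leaves t) (vzero H)"
      using \<xi> by (auto simp: list_eq_iff_nth_eq nth_dec length_dec)
    then show "vadd K_space x (dc t (map (vscale H (-1)) \<xi>)) = vzero K_space"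
      using \<xi> by (simp add: simps K_space_zero[of t])
    show "dc t (map (vscale H (-1)) \<xi>) \<in> carrier K_space"
      using \<xi> by (simp add: simps)
  qed
  show "vscale K_space (c + d) x = vadd K_space (vscale K_space c x) (vscale K_space d x)" for c d
  proof -
    have "map (vscale H (c + d)) \<xi> = map2 (vadd H) (map (vscale H c) \<xi>) (map (vscale H d) \<xi>)"
      using \<xi> by (auto simp: list_eq_iff_nth_eq nth_dec length_dec scale_add_left)
    then show ?thesis using \<xi> by (simp add: simps)
  qed
  show "vscale K_space c (vscale K_space d x) = vscale K_space (c * d) x" for c d
  proof -
    have "map (vscale H c) (map (vscale H d) \<xi>) = map (vscale H (c * d)) \<xi>"
      using \<xi> by (auto simp: list_eq_iff_nth_eq nth_dec length_dec scale_scale)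
    then show ?thesis using \<xi> by (simp add: simps del: map_map)
  qed
  show "vscale K_space 1 x = x"
  proof -
    have "map (vscale H 1) \<xi> = \<xi>"
      using \<xi> by (auto simp: list_eq_iff_nth_eq nth_dec length_dec scale_one)
    then show ?thesis using \<xi> by (simp add: simps)
  qed
  show "Re (vinner K_space x x) > 0" if "x \<noteq> vzero K_space"
  proof -
    have "\<xi> \<noteq> replicate (leaves t) (vzero H)"
      using that \<xi> by (auto simp: K_space_zero[of t])
    then show ?thesis
      using \<xi> list_inner_self_pos(2)[of \<xi>] by (simp add: simps length_dec set_dec)
  qed
  fix y assume y: "y \<in> carrier K_space"
  show "vadd K_space x y \<in> carrier K_space" "vadd K_space x y = vadd K_space y x"
    "vscale K_space c (vadd K_space x y) = vadd K_space (vscale K_space c x) (vscale K_space c y)"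
    "vinner K_space (vscale K_space c x) y = c * vinner K_space x y"
    "vinner K_space x y = cnj (vinner K_space y x)" for c
  proof -
    obtain t \<xi> \<eta> where *: "\<xi> \<in> decorations H t" "\<eta> \<in> decorations H t" "x = dc t \<xi>" "y = dc t \<eta>"
      using rep[OF x y y] by blast
    show "vadd K_space x y \<in> carrier K_space"
      using * by (simp add: simps)
    have "map2 (vadd H) \<xi> \<eta> = map2 (vadd H) \<eta> \<xi>"
      using * by (auto simp: list_eq_iff_nth_eq nth_dec length_dec intro!: add_commute)
    then show "vadd K_space x y = vadd K_space y x"
      using * by (simp add: simps)
    have "map (vscale H c) (map2 (vadd H) \<xi> \<eta>) = map2 (vadd H) (map (vscale H c) \<xi>) (map (vscale H c) \<eta>)"
      using * by (auto simp: list_eq_iff_nth_eq nth_dec length_dec scale_add_right)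
    then show "vscale K_space c (vadd K_space x y) = vadd K_space (vscale K_space c x) (vscale K_space c y)"
      using * by (simp add: simps del: map_map)
    show "vinner K_space (vscale K_space c x) y = c * vinner K_space x y"
      using * list_inner_scale[of \<xi> \<eta> c] by (simp add: simps length_dec set_dec)
    show "vinner K_space x y = cnj (vinner K_space y x)"
      using * list_inner_commute[of \<xi> \<eta>] by (simp add: simps length_dec set_dec)
  qed
  fix z assume z: "z \<in> carrier K_space"
  show "vadd K_space (vadd K_space x y) z = vadd K_space x (vadd K_space y z)"
    "vinner K_space (vadd K_space x y) z = vinner K_space x z + vinner K_space y z"
  proof -
    obtain t \<xi> \<eta> \<zeta> where *: "\<xi> \<in> decorations H t" "\<eta> \<in> decorations H t" "\<zeta> \<in> decorations H t"
        "x = dc t \<xi>" "y = dc t \<eta>" "z = dc t \<zeta>"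
      using rep[OF x y z] by blast
    have "map2 (vadd H) (map2 (vadd H) \<xi> \<eta>) \<zeta> = map2 (vadd H) \<xi> (map2 (vadd H) \<eta> \<zeta>)"
      using * by (auto simp: list_eq_iff_nth_eq nth_dec length_dec add_assoc)
    then show "vadd K_space (vadd K_space x y) z = vadd K_space x (vadd K_space y z)"
      using * by (simp add: simps)
    show "vinner K_space (vadd K_space x y) z = vinner K_space x z + vinner K_space y z"
      using * list_inner_add[of \<xi> \<eta> \<zeta>] by (simp add: simps length_dec set_dec)
  qed
qed

section \<open>The action of Thompson's group on decorated trees\<close>

lemma dec_action_class:
  assumes "leaves t = leaves s" "\<xi> \<in> decorations H s"
  shows "dec_action H A B (fclass t s) (dc s \<xi>) = dc t \<xi>"
  unfolding dec_action_def
proof (rule the_equality)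
  fix w assume "\<exists>t' s' \<xi>'. leaves t' = leaves s' \<and> \<xi>' \<in> decorations H s' \<and>
     fclass t s = fclass t' s' \<and> dc s \<xi> = dc s' \<xi>' \<and> w = dc t' \<xi>'"
  then obtain t' s' \<xi>' where *: "leaves t' = leaves s'" "\<xi>' \<in> decorations H s'"
      "fclass t s = fclass t' s'" "dc s \<xi> = dc s' \<xi>'" "w = dc t' \<xi>'"
    by blast
  show "w = dc t \<xi>"
    unfolding *(5) by (rule dec_action_well_defined[OF *(3,4) assms(1) *(1) assms(2) *(2), symmetric])
qed (use assms in blast)

lemma dec_action_rep:
  assumes "g \<in> carrier thompson_F" "x \<in> carrier K_space" "y \<in> carrier K_space"
  obtains t s \<xi> \<eta> where "leaves t = leaves s" "\<xi> \<in> decorations H s" "\<eta> \<in> decorations H s"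
    "g = fclass t s" "x = dc s \<xi>" "y = dc s \<eta>"
proof -
  obtain t s where g: "leaves t = leaves s" "g = fclass t s"
    using assms(1) by (auto simp: carrier_thompson)
  obtain u \<xi> \<eta> where u: "\<xi> \<in> decorations H u" "\<eta> \<in> decorations H u" "x = dc u \<xi>" "y = dc u \<eta>"
    using common_tree[of "{x, y}"] assms(2,3)
    by (metis empty_subsetI finite.intros insert_iff insert_subset)
  obtain f h where fh: "length f = leaves s" "length h = leaves u" "graft f s = graft h u"
    using common_refinement by blast
  have "g = fclass (graft f t) (graft f s)"
    using g fh fclass_graft[of t s f] by simp
  moreover have "x = dc (graft f s) (Phi A B h \<xi>)" "y = dc (graft f s) (Phi A B h \<eta>)"
    using u fh dec_class_graft[of _ u h] by auto
  moreover have "leaves (graft f t) = leaves (graft f s)"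
    using g leaves_graft[of f t] leaves_graft[of f s] fh(1) by simp
  moreover have "Phi A B h \<xi> \<in> decorations H (graft f s)" "Phi A B h \<eta> \<in> decorations H (graft f s)"
    using u fh dec.act_leaves[of _ u h] by (auto simp: decorations_eq)
  ultimately show ?thesis using that by blast
qed

text \<open>An element of \<open>F\<close> changes the tree but not the list of vectors on its
  leaves, and norms and distances are computed from the list alone.\<close>

lemma dec_action_isometry:
  assumes "g \<in> carrier thompson_F" "x \<in> carrier K_space" "y \<in> carrier K_space"
  shows "dec_action H A B g x \<in> carrier K_space"
    and "vnorm K_space (dec_action H A B g x) = vnorm K_space x"
    and "vdist K_space (dec_action H A B g x) (dec_action H A B g y) = vdist K_space x y"
proof -
  obtain t s \<xi> \<eta> where *: "leaves t = leaves s" "\<xi> \<in> decorations H s" "\<eta> \<in> decorations H s"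
      "g = fclass t s" "x = dc s \<xi>" "y = dc s \<eta>"
    using dec_action_rep[OF assms] by blast
  have t: "\<xi> \<in> decorations H t" "\<eta> \<in> decorations H t"
    using * by (auto simp: decorations_iff)
  show "dec_action H A B g x \<in> carrier K_space"
    "vnorm K_space (dec_action H A B g x) = vnorm K_space x"
    "vdist K_space (dec_action H A B g x) (dec_action H A B g y) = vdist K_space x y"
    using * t by (simp_all add: dec_action_class vnorm_def vdist_def K_space_add K_space_scale
        K_space_inner map2_add_dec map_scale_dec)
qed

text \<open>The element carries a decoration of \<open>f \<circ> s\<close> to the same list on
  \<open>f' \<circ> s\<close>. Refining \<open>\<xi>\<close> along \<open>f\<close> and
  \<open>\<eta>\<close> along \<open>f'\<close> therefore puts both vectors on the tree
  \<open>f' \<circ> s\<close>, where the inner product is taken entry by entry.\<close>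

lemma coefficient_graft:
  assumes "\<xi> \<in> decorations H s" "\<eta> \<in> decorations H s" "length f = leaves s" "length f' = leaves s"
    and "map leaves f = map leaves f'"
  shows "vinner K_space (dec_action H A B (fclass (graft f' s) (graft f s)) (dc s \<xi>)) (dc s \<eta>)
    = list_inner (Phi A B f \<xi>) (Phi A B f' \<eta>)"
proof -
  have l: "leaves (graft f' s) = leaves (graft f s)"
    using assms by (simp add: leaves_graft)
  have d: "Phi A B f \<xi> \<in> decorations H (graft f s)" "Phi A B f \<xi> \<in> decorations H (graft f' s)"
      "Phi A B f' \<eta> \<in> decorations H (graft f' s)"
    using assms l dec.act_leaves[of \<xi> s f] dec.act_leaves[of \<eta> s f'] by (auto simp: decorations_eq)
  have "dec_action H A B (fclass (graft f' s) (graft f s)) (dc s \<xi>) = dc (graft f' s) (Phi A B f \<xi>)"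
    using dec_action_class[OF l d(1)] dec_class_graft[OF assms(1,3)] by simp
  moreover have "dc s \<eta> = dc (graft f' s) (Phi A B f' \<eta>)"
    using dec_class_graft[OF assms(2,4)] by simp
  ultimately show ?thesis
    using K_space_inner d by simp
qed

end

section \<open>Coefficients of vine elements\<close>

fun right_vine :: "nat \<Rightarrow> tree \<Rightarrow> tree" where
  "right_vine 0 u = u"
| "right_vine (Suc n) u = Node Leaf (right_vine n u)"

fun left_vine :: "nat \<Rightarrow> tree \<Rightarrow> tree" where
  "left_vine 0 u = u"
| "left_vine (Suc n) u = Node (left_vine n u) Leaf"

lemma leaves_vine [simp]:
  "leaves (right_vine n u) = n + leaves u" "leaves (left_vine n u) = leaves u + n"
  by (induction n) auto

context pythagorean
begin

text \<open>A non-empty list decorates some tree with that many leaves, here a right vine, so the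
  inequality in the direct limit applies.\<close>

lemma list_Cauchy_Schwarz:
  assumes "length xs = length ys" "set xs \<subseteq> carrier H" "set ys \<subseteq> carrier H"
  shows "cmod (list_inner xs ys) \<le> sqrt (Re (list_inner xs xs)) * sqrt (Re (list_inner ys ys))"
proof (cases "xs = []")
  case True
  then show ?thesis using assms by simp
next
  case False
  then have "leaves (right_vine (length xs - 1) Leaf) = length xs"
    by (cases xs) auto
  then have "xs \<in> decorations H (right_vine (length xs - 1) Leaf)"
      "ys \<in> decorations H (right_vine (length xs - 1) Leaf)"
    using assms by (simp_all add: decorations_iff)
  then show ?thesis
    using Ks.Cauchy_Schwarz[of "dc (right_vine (length xs - 1) Leaf) xs" "dc (right_vine (length xs - 1) Leaf) ys"]
    by (simp add: K_space_inner vnorm_def)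
qed

lemma power_closed: "x \<in> carrier H \<Longrightarrow> (A ^^ n) x \<in> carrier H" "x \<in> carrier H \<Longrightarrow> (B ^^ n) x \<in> carrier H"
  by (induction n) auto

lemma Phi_right_vine:
  assumes "x \<in> carrier H"
  obtains ps where "length ps = n" "set ps \<subseteq> carrier H"
    "Phi_tree A B (right_vine n u) x = ps @ Phi_tree A B u ((B ^^ n) x)"
proof -
  have "\<exists>ps. length ps = n \<and> set ps \<subseteq> carrier H \<and>
      Phi_tree A B (right_vine n u) x = ps @ Phi_tree A B u ((B ^^ n) x)"
    using assms
  proof (induction n arbitrary: x)
    case (Suc n)
    then obtain ps where "length ps = n" "set ps \<subseteq> carrier H"
        "Phi_tree A B (right_vine n u) (B x) = ps @ Phi_tree A B u ((B ^^ n) (B x))"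
      using AB_closed(2) by blast
    then show ?case
      using Suc.prems by (intro exI[of _ "A x # ps"]) (simp add: funpow_swap1)
  qed simp
  then show ?thesis using that by blast
qed

lemma Phi_left_vine:
  assumes "x \<in> carrier H"
  obtains qs where "length qs = n" "set qs \<subseteq> carrier H"
    "Phi_tree A B (left_vine n u) x = Phi_tree A B u ((A ^^ n) x) @ qs"
proof -
  have "\<exists>qs. length qs = n \<and> set qs \<subseteq> carrier H \<and>
      Phi_tree A B (left_vine n u) x = Phi_tree A B u ((A ^^ n) x) @ qs"
    using assms
  proof (induction n arbitrary: x)
    case (Suc n)
    then obtain qs where "length qs = n" "set qs \<subseteq> carrier H"
        "Phi_tree A B (left_vine n u) (A x) = Phi_tree A B u ((A ^^ n) (A x)) @ qs"
      using AB_closed(1) by blast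
    then show ?case
      using Suc.prems by (intro exI[of _ "qs @ [B x]"]) (simp add: funpow_swap1)
  qed simp
  then show ?thesis using that by blast
qed

text \<open>Both lists have \<open>2 * n\<close> entries. The last \<open>n\<close> entries of the
  first list come from \<open>(B ^^ n) x\<close>, and the first \<open>n\<close> entries of the
  second from \<open>(A ^^ n) y\<close>. As \<open>u\<close> and \<open>u'\<close> have exactly
  \<open>n\<close> leaves, the lists break at the same place, and each half pairs one of these
  blocks with a block whose norm is bounded by that of \<open>x\<close> or \<open>y\<close>.\<close>

lemma vine_coefficient_le:
  assumes "x \<in> carrier H" "y \<in> carrier H" "leaves u = n" "leaves u' = n"
  shows "cmod (list_inner (Phi_tree A B (right_vine n u) x) (Phi_tree A B (left_vine n u') y))
    \<le> vnorm H x * vnorm H ((A ^^ n) y) + vnorm H ((B ^^ n) x) * vnorm H y"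
proof -
  let ?a = "Phi_tree A B u' ((A ^^ n) y)" and ?b = "Phi_tree A B u ((B ^^ n) x)"
  obtain ps where ps: "length ps = n" "set ps \<subseteq> carrier H"
      "Phi_tree A B (right_vine n u) x = ps @ ?b"
    using Phi_right_vine assms(1) by blast
  obtain qs where qs: "length qs = n" "set qs \<subseteq> carrier H"
      "Phi_tree A B (left_vine n u') y = ?a @ qs"
    using Phi_left_vine assms(2) by blast
  have c: "set ?a \<subseteq> carrier H" "set ?b \<subseteq> carrier H"
    using assms Phi_tree_closed power_closed by auto
  have na: "Re (list_inner ?a ?a) = (vnorm H ((A ^^ n) y))\<^sup>2"
    "Re (list_inner ?b ?b) = (vnorm H ((B ^^ n) x))\<^sup>2"
    using assms by (simp_all add: list_inner_Phi_tree power_closed inner_self)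
  have "list_inner (ps @ ?b) (ps @ ?b) = vinner H x x"
    using list_inner_Phi_tree[OF assms(1,1), of "right_vine n u"] ps(3) by simp
  then have "Re (list_inner ps ps) \<le> (vnorm H x)\<^sup>2"
    using list_inner_self_pos(1)[OF c(2)] assms by (simp add: list_inner_append inner_self complex_eq_iff)
  then have nps: "sqrt (Re (list_inner ps ps)) \<le> vnorm H x"
    using assms by (simp add: real_le_lsqrt)
  have "list_inner (?a @ qs) (?a @ qs) = vinner H y y"
    using list_inner_Phi_tree[OF assms(2,2), of "left_vine n u'"] qs(3) by simp
  then have "Re (list_inner qs qs) \<le> (vnorm H y)\<^sup>2"
    using list_inner_self_pos(1)[OF c(1)] assms by (simp add: list_inner_append inner_self complex_eq_iff)
  then have nqs: "sqrt (Re (list_inner qs qs)) \<le> vnorm H y"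
    using assms by (simp add: real_le_lsqrt)
  have "list_inner (Phi_tree A B (right_vine n u) x) (Phi_tree A B (left_vine n u') y)
      = list_inner ps ?a + list_inner ?b qs"
    unfolding ps(3) qs(3) using ps(1) assms by (simp add: list_inner_append)
  also have "cmod \<dots> \<le> cmod (list_inner ps ?a) + cmod (list_inner ?b qs)"
    by (rule norm_triangle_ineq)
  also have "\<dots> \<le> sqrt (Re (list_inner ps ps)) * sqrt (Re (list_inner ?a ?a))
      + sqrt (Re (list_inner ?b ?b)) * sqrt (Re (list_inner qs qs))"
    using ps qs assms c by (intro add_mono list_Cauchy_Schwarz) auto
  also have "\<dots> \<le> vnorm H x * vnorm H ((A ^^ n) y) + vnorm H ((B ^^ n) x) * vnorm H y"
    using nps nqs assms power_closed list_inner_self_pos(1)[OF ps(2)] list_inner_self_pos(1)[OF qs(2)]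
    by (intro add_mono mult_mono) (auto simp: na real_sqrt_abs)
  finally show ?thesis .
qed

text \<open>The two forests differ only at leaf \<open>i\<close>. Every other leaf contributes its
  full squared norm, because refinement is isometric. Leaf \<open>i\<close> contributes at least
  minus its squared norm by Cauchy-Schwarz, hence the factor 2.\<close>

lemma one_leaf_coefficient:
  assumes "leaves a = leaves b" "set \<xi> \<subseteq> carrier H" "i < length \<xi>"
  shows "Re (list_inner \<xi> \<xi>) - 2 * (vnorm H (\<xi> ! i))\<^sup>2
    \<le> Re (list_inner (Phi A B (replicate i a @ replicate (length \<xi> - i) b) \<xi>)
        (Phi A B (replicate (Suc i) a @ replicate (length \<xi> - Suc i) b) \<xi>))"
proof -
  define \<alpha> x \<beta> where "\<alpha> = take i \<xi>" and "x = \<xi> ! i" and "\<beta> = drop (Suc i) \<xi>"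
  have \<xi>: "\<xi> = \<alpha> @ x # \<beta>" and i: "length \<alpha> = i"
    using assms(3) by (simp_all add: \<alpha>_def x_def \<beta>_def id_take_nth_drop)
  have c: "set \<alpha> \<subseteq> carrier H" "x \<in> carrier H" "set \<beta> \<subseteq> carrier H"
    using assms(2) \<xi> by auto
  let ?f = "replicate i a" and ?g = "replicate (length \<beta>) b"
  have s: "replicate i a @ replicate (length \<xi> - i) b = ?f @ b # ?g"
    "replicate (Suc i) a @ replicate (length \<xi> - Suc i) b = ?f @ a # ?g"
    using i by (simp_all add: \<xi> replicate_append_same[symmetric])
  have "list_inner (Phi A B (?f @ b # ?g) \<xi>) (Phi A B (?f @ a # ?g) \<xi>)
      = list_inner \<alpha> \<alpha> + (list_inner (Phi_tree A B b x) (Phi_tree A B a x) + list_inner \<beta> \<beta>)"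
    using c i assms(1) by (simp add: \<xi> Phi_append list_inner_append list_inner_Phi)
  moreover have "list_inner \<xi> \<xi> = list_inner \<alpha> \<alpha> + (vinner H x x + list_inner \<beta> \<beta>)"
    by (simp add: \<xi> list_inner_append)
  moreover have "cmod (list_inner (Phi_tree A B b x) (Phi_tree A B a x)) \<le> (vnorm H x)\<^sup>2"
    using list_Cauchy_Schwarz[of "Phi_tree A B b x" "Phi_tree A B a x"] assms(1) c Phi_tree_closed
    by (simp add: list_inner_Phi_tree inner_self power2_eq_square)
  moreover have "- cmod (list_inner (Phi_tree A B b x) (Phi_tree A B a x))
      \<le> Re (list_inner (Phi_tree A B b x) (Phi_tree A B a x))"
    using abs_Re_le_cmod[of "list_inner (Phi_tree A B b x) (Phi_tree A B a x)"] by linarith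
  moreover have "Re (vinner H x x) = (vnorm H x)\<^sup>2"
    using c by (simp add: inner_self)
  ultimately show ?thesis
    unfolding s x_def[symmetric] by simp
qed

end

section \<open>Consequences of diffuseness\<close>

locale diffuse_pair = pythagorean +
  assumes diffuse: "diffuse H A B"
begin

lemma norm_iterate_tendsto:
  assumes "\<And>k. k \<ge> 1 \<Longrightarrow> x k \<in> {A, B}" "\<xi> \<in> carrier H"
  shows "(\<lambda>n. vnorm H (iterate x n \<xi>)) \<longlonglongrightarrow> 0"
proof -
  have "iterate x n \<xi> \<in> carrier H" for n
  proof (induction n)
    case (Suc n)
    have "x (Suc n) = A \<or> x (Suc n) = B"
      using assms(1)[of "Suc n"] by simp
    then show ?case
      by (elim disjE) (simp_all add: Suc)
  qed (use assms in simp)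
  moreover have "vconv H (\<lambda>n. iterate x n \<xi>) (vzero H)"
    using diffuse assms unfolding diffuse_def by blast
  ultimately show ?thesis
    by (simp add: vconv_def dist_zero)
qed

lemma norm_power_tendsto:
  assumes "\<xi> \<in> carrier H"
  shows "(\<lambda>n. vnorm H ((A ^^ n) \<xi>)) \<longlonglongrightarrow> 0" "(\<lambda>n. vnorm H ((B ^^ n) \<xi>)) \<longlonglongrightarrow> 0"
proof -
  have it: "iterate (\<lambda>_. T) n \<xi> = (T ^^ n) \<xi>" for T n
    by (induction n) auto
  show "(\<lambda>n. vnorm H ((A ^^ n) \<xi>)) \<longlonglongrightarrow> 0" "(\<lambda>n. vnorm H ((B ^^ n) \<xi>)) \<longlonglongrightarrow> 0"
    using norm_iterate_tendsto[of "\<lambda>_. A" \<xi>] norm_iterate_tendsto[of "\<lambda>_. B" \<xi>] assms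
    by (simp_all add: it)
qed

text \<open>Koenig's lemma: a vector without such a tree has a child \<open>A \<xi>\<close> or \<open>B \<xi>\<close> without one,
  which produces an infinite path along which the norms do not tend to zero.\<close>

lemma small_tree:
  assumes "\<xi> \<in> carrier H" "e > 0"
  shows "\<exists>t. \<forall>y\<in>set (Phi_tree A B t \<xi>). vnorm H y < e"
proof (rule ccontr)
  define bad where "bad x \<longleftrightarrow> x \<in> carrier H \<and> \<not> (\<exists>t. \<forall>y\<in>set (Phi_tree A B t x). vnorm H y < e)" for x
  assume "\<not> ?thesis"
  then have \<xi>: "bad \<xi>"
    using assms by (simp add: bad_def)
  have large: "vnorm H x \<ge> e" if "bad x" for x
  proof (rule ccontr)
    assume "\<not> vnorm H x \<ge> e"
    then have "\<forall>y\<in>set (Phi_tree A B Leaf x). vnorm H y < e"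
      by simp
    then show False using that unfolding bad_def by blast
  qed
  have child: "bad (A x) \<or> bad (B x)" if "bad x" for x
  proof (rule ccontr)
    assume "\<not> (bad (A x) \<or> bad (B x))"
    moreover have "x \<in> carrier H"
      using that by (simp add: bad_def)
    ultimately obtain l r where "\<forall>y\<in>set (Phi_tree A B l (A x)). vnorm H y < e"
        "\<forall>y\<in>set (Phi_tree A B r (B x)). vnorm H y < e"
      by (auto simp: bad_def)
    then have "\<forall>y\<in>set (Phi_tree A B (Node l r) x). vnorm H y < e"
      by auto
    then show False using that unfolding bad_def by blast
  qed
  define c where "c x = (if bad (A x) then A else B)" for x
  define z where "z = rec_nat \<xi> (\<lambda>_ x. c x x)"
  have z: "z 0 = \<xi>" "z (Suc n) = c (z n) (z n)" for n
    by (simp_all add: z_def)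
  have bad: "bad (z n)" for n
    by (induction n) (use \<xi> child in \<open>auto simp: z c_def\<close>)
  \<comment> \<open>\<open>iterate\<close> begins with \<open>x 1\<close>, which has to be the
    choice made at \<open>z 0\<close>; hence the shift. The value at \<open>0\<close> is never
    applied.\<close>
  define x where "x k = c (z (k - 1))" for k
  have "iterate x n \<xi> = z n" for n
    by (induction n) (auto simp: z x_def)
  moreover have "x k \<in> {A, B}" for k
    by (simp add: x_def c_def)
  ultimately have "(\<lambda>n. vnorm H (z n)) \<longlonglongrightarrow> 0"
    using norm_iterate_tendsto[of x \<xi>] assms by simp
  then have "\<forall>\<^sub>F n in sequentially. vnorm H (z n) < e"
    using assms(2) order_tendstoD(2) by blast
  then show False
    using large[OF bad] by (auto simp: eventually_sequentially not_less[symmetric])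
qed

lemma small_forest:
  assumes "set \<xi> \<subseteq> carrier H" "e > 0"
  shows "\<exists>f. length f = length \<xi> \<and> (\<forall>y\<in>set (Phi A B f \<xi>). vnorm H y < e)"
  using assms(1)
proof (induction \<xi>)
  case (Cons x \<xi>)
  then obtain f where f: "length f = length \<xi>" "\<forall>y\<in>set (Phi A B f \<xi>). vnorm H y < e"
    by auto
  obtain t where "\<forall>y\<in>set (Phi_tree A B t x). vnorm H y < e"
    using small_tree[of x e] Cons.prems assms(2) by auto
  then show ?case
    using f by (intro exI[of _ "t # f"]) auto
qed simp

text \<open>A spine of length \<open>m + 1\<close> is extended at its end by a tree with
  \<open>m + 1\<close> leaves. This makes the two blocks of \<open>vine_coefficient_le\<close>
  equally long and gives source and target the same number \<open>2 * m + 2\<close> of leaves. Of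
  the extending tree only the leaf count matters.\<close>

abbreviation source_vine :: "nat \<Rightarrow> tree" where
  "source_vine m \<equiv> right_vine (Suc m) (right_vine m Leaf)"

abbreviation target_vine :: "nat \<Rightarrow> tree" where
  "target_vine m \<equiv> left_vine (Suc m) (right_vine m Leaf)"

lemma vine_coefficient_tendsto:
  assumes "x \<in> carrier H" "y \<in> carrier H"
  shows "(\<lambda>m. list_inner (Phi_tree A B (source_vine m) x) (Phi_tree A B (target_vine m) y)) \<longlonglongrightarrow> 0"
proof (rule tendsto_0_le)
  have "(\<lambda>n. vnorm H x * vnorm H ((A ^^ n) y) + vnorm H ((B ^^ n) x) * vnorm H y) \<longlonglongrightarrow>
      vnorm H x * 0 + 0 * vnorm H y"
    using assms by (intro tendsto_intros norm_power_tendsto)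
  then show "(\<lambda>m. vnorm H x * vnorm H ((A ^^ Suc m) y) + vnorm H ((B ^^ Suc m) x) * vnorm H y) \<longlonglongrightarrow> 0"
    using LIMSEQ_Suc by fastforce
  show "\<forall>\<^sub>F m in sequentially.
      cmod (list_inner (Phi_tree A B (source_vine m) x) (Phi_tree A B (target_vine m) y))
      \<le> norm (vnorm H x * vnorm H ((A ^^ Suc m) y) + vnorm H ((B ^^ Suc m) x) * vnorm H y) * 1"
  proof (intro always_eventually allI)
    fix m
    show "cmod (list_inner (Phi_tree A B (source_vine m) x) (Phi_tree A B (target_vine m) y))
      \<le> norm (vnorm H x * vnorm H ((A ^^ Suc m) y) + vnorm H ((B ^^ Suc m) x) * vnorm H y) * 1"
      using vine_coefficient_le[OF assms, of "right_vine m Leaf" "Suc m" "right_vine m Leaf"]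
      by (simp only: leaves_vine) auto
  qed
qed

lemma vine_coefficient_list_tendsto:
  assumes "length \<xi> = length \<eta>" "set \<xi> \<subseteq> carrier H" "set \<eta> \<subseteq> carrier H"
  shows "(\<lambda>m. list_inner (Phi A B (replicate (length \<xi>) (source_vine m)) \<xi>)
    (Phi A B (replicate (length \<xi>) (target_vine m)) \<eta>)) \<longlonglongrightarrow> 0"
  using assms
proof (induction \<xi> \<eta> rule: list_induct2)
  case (Cons x \<xi> y \<eta>)
  have "(\<lambda>m. list_inner (Phi_tree A B (source_vine m) x) (Phi_tree A B (target_vine m) y)
      + list_inner (Phi A B (replicate (length \<xi>) (source_vine m)) \<xi>)
        (Phi A B (replicate (length \<xi>) (target_vine m)) \<eta>)) \<longlonglongrightarrow> 0 + 0"
    using Cons by (intro tendsto_add vine_coefficient_tendsto) auto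
  then show ?case
    by (simp add: list_inner_append del: right_vine.simps left_vine.simps)
qed simp

text \<open>The trees \<open>T i\<close> below carry the target vine on the first \<open>i\<close> leaves of \<open>s\<close> and the source vine on
  the others. As \<open>[T (i + 1), T i]\<close> changes \<open>v\<close> only over one leaf of \<open>s\<close>, where \<open>v\<close> is small, it lies in
  \<open>K\<close>; the product of these elements shrinks all coefficients simultaneously.\<close>

lemma exists_small_coefficients:
  assumes "subgroup K thompson_F" "finite W" "W \<subseteq> carrier K_space" "v \<in> carrier K_space" "e > 0"
    and gap: "d < (vnorm K_space v)\<^sup>2"
    and big: "\<And>g. \<lbrakk>g \<in> carrier thompson_F; g \<notin> K\<rbrakk> \<Longrightarrow> Re (vinner K_space (dec_action H A B g v) v) \<le> d"
  shows "\<exists>h\<in>K. \<forall>w\<in>W. cmod (vinner K_space (dec_action H A B h v) w) < e"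
proof -
  have "finite (insert v W)" "insert v W \<subseteq> carrier K_space"
    using assms by auto
  then obtain u \<xi>0 where \<xi>0: "\<And>z. z \<in> insert v W \<Longrightarrow> \<xi>0 z \<in> decorations H u"
      "\<And>z. z \<in> insert v W \<Longrightarrow> z = dc u (\<xi>0 z)"
    by (rule common_tree) blast
  \<comment> \<open>Chosen so that the greatest possible loss at one leaf,
    \<open>2 * \<delta>\<^sup>2\<close>, equals the gap between the squared norm of \<open>v\<close>
    and \<open>d\<close>.\<close>
  define \<delta> where "\<delta> = sqrt (((vnorm K_space v)\<^sup>2 - d) / 2)"
  have \<delta>: "\<delta> > 0" "2 * \<delta>\<^sup>2 = (vnorm K_space v)\<^sup>2 - d"
    using gap by (simp_all add: \<delta>_def)
  obtain f where f: "length f = leaves u" "\<forall>y\<in>set (Phi A B f (\<xi>0 v)). vnorm H y < \<delta>"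
    using small_forest[OF set_dec \<delta>(1)] \<xi>0(1)[of v] length_dec by fastforce
  define s where "s = graft f u"
  \<comment> \<open>The forest is chosen to make the entries of \<open>v\<close> small, but it
    refines all of \<open>W\<close> as well, so that every coefficient is computed over the single
    tree \<open>s\<close>.\<close>
  have refine: "Phi A B f (\<xi>0 z) \<in> decorations H s" "z = dc s (Phi A B f (\<xi>0 z))" if "z \<in> insert v W" for z
    using \<xi>0[OF that] f(1) dec.act_leaves[of "\<xi>0 z" u f] dec_class_graft[of "\<xi>0 z" u f]
    by (auto simp: s_def decorations_eq)
  then obtain \<zeta> where v: "\<zeta> \<in> decorations H s" "v = dc s \<zeta>"
    and small: "\<forall>y\<in>set \<zeta>. vnorm H y < \<delta>"
    using f(2) by blast
  have norm_v: "Re (list_inner \<zeta> \<zeta>) = (vnorm K_space v)\<^sup>2"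
    unfolding K_space_inner[OF v(1,1), symmetric] v(2)[symmetric] Ks.inner_self[OF assms(4)] by simp
  define F where "F m i = replicate i (target_vine m) @ replicate (leaves s - i) (source_vine m)" for m i
  define T where "T m i = graft (F m i) s" for m i
  have F: "length (F m i) = leaves s" "map leaves (F m i) = replicate (leaves s) (2 * m + 2)"
    if "i \<le> leaves s" for m i
    using that by (simp_all add: F_def replicate_add[symmetric])
  have T: "leaves (T m i) = leaves (T m j)" if "i \<le> leaves s" "j \<le> leaves s" for m i j
    using F[OF that(1), of m] F[OF that(2), of m] by (simp add: T_def leaves_graft)
  \<comment> \<open>Outside \<open>K\<close> the coefficient would be at most \<open>d\<close>. The
    exchange at leaf \<open>i\<close> loses strictly less than \<open>2 * \<delta>\<^sup>2\<close>,
    which leaves the coefficient above \<open>d\<close>.\<close>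
  have step: "fclass (T m (Suc i)) (T m i) \<in> K" if "i < leaves s" for m i
  proof (rule ccontr)
    assume "fclass (T m (Suc i)) (T m i) \<notin> K"
    then have "Re (vinner K_space (dec_action H A B (fclass (T m (Suc i)) (T m i)) v) v) \<le> d"
      using that T by (intro big) auto
    moreover have "vinner K_space (dec_action H A B (fclass (T m (Suc i)) (T m i)) (dc s \<zeta>)) (dc s \<zeta>)
        = list_inner (Phi A B (F m i) \<zeta>) (Phi A B (F m (Suc i)) \<zeta>)"
      unfolding T_def using that F[of i m] F[of "Suc i" m] by (intro coefficient_graft v(1)) auto
    moreover have "Re (list_inner \<zeta> \<zeta>) - 2 * (vnorm H (\<zeta> ! i))\<^sup>2
        \<le> Re (list_inner (Phi A B (F m i) \<zeta>) (Phi A B (F m (Suc i)) \<zeta>))"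
      using one_leaf_coefficient[of "target_vine m" "source_vine m" \<zeta> i] that length_dec[OF v(1)]
        set_dec[OF v(1)] by (simp add: F_def del: right_vine.simps left_vine.simps replicate_Suc)
    moreover have "vnorm H (\<zeta> ! i) < \<delta>" "0 \<le> vnorm H (\<zeta> ! i)"
      using small that length_dec[OF v(1)] nth_dec[OF v(1)] by auto
    then have "(vnorm H (\<zeta> ! i))\<^sup>2 < \<delta>\<^sup>2"
      by (simp add: power_strict_mono)
    ultimately show False
      using \<delta>(2) norm_v v(2) by simp
  qed
  have prod: "fclass (T m i) (T m 0) \<in> K" if "i \<le> leaves s" for m i
    using that
  proof (induction i)
    case 0
    show ?case
      using subgroup.one_closed[OF assms(1)] by (simp add: one_thompson[of "T m 0"])
  next
    case (Suc i)
    then have "fclass (T m (Suc i)) (T m i) \<otimes>\<^bsub>thompson_F\<^esub> fclass (T m i) (T m 0) \<in> K"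
      using step by (intro subgroup.m_closed[OF assms(1)]) auto
    then show ?case
      using T[of "Suc i" i m] T[of i 0 m] Suc.prems by (simp add: fclass_mult)
  qed
  \<comment> \<open>The tree \<open>s\<close> does not depend on \<open>m\<close>, so each
    coefficient is a sum of a fixed number of terms, all vanishing in the limit.\<close>
  have "(\<lambda>m. vinner K_space (dec_action H A B (fclass (T m (leaves s)) (T m 0)) v) w) \<longlonglongrightarrow> 0"
    if wW: "w \<in> W" for w
  proof -
    obtain \<eta> where w: "\<eta> \<in> decorations H s" "w = dc s \<eta>"
      by (rule that[OF refine(1,2)[of w]]) (use wW in auto)
    have "vinner K_space (dec_action H A B (fclass (T m (leaves s)) (T m 0)) (dc s \<zeta>)) (dc s \<eta>)
      = list_inner (Phi A B (F m 0) \<zeta>) (Phi A B (F m (leaves s)) \<eta>)" for m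
      unfolding T_def using F[of 0 m] F[of "leaves s" m] by (intro coefficient_graft v(1) w(1)) auto
    moreover have "(\<lambda>m. list_inner (Phi A B (F m 0) \<zeta>) (Phi A B (F m (leaves s)) \<eta>)) \<longlonglongrightarrow> 0"
      using vine_coefficient_list_tendsto[of \<zeta> \<eta>] length_dec[OF v(1)] length_dec[OF w(1)]
        set_dec[OF v(1)] set_dec[OF w(1)] by (simp add: F_def del: right_vine.simps left_vine.simps)
    ultimately show ?thesis
      using v(2) w(2) by simp
  qed
  then have "\<forall>w\<in>W. \<forall>\<^sub>F m in sequentially.
      cmod (vinner K_space (dec_action H A B (fclass (T m (leaves s)) (T m 0)) v) w) < e"
    using assms(5) order_tendstoD(2)[OF tendsto_norm_zero] by blast
  then have "\<forall>\<^sub>F m in sequentially. \<forall>w\<in>W.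
      cmod (vinner K_space (dec_action H A B (fclass (T m (leaves s)) (T m 0)) v) w) < e"
    using assms(2) by (rule eventually_ball_finite[rotated])
  from eventually_happens'[OF sequentially_bot this]
  obtain m where "\<forall>w\<in>W. cmod (vinner K_space (dec_action H A B (fclass (T m (leaves s)) (T m 0)) v) w) < e"
    by blast
  then show ?thesis
    using prod[of "leaves s" m] by blast
qed

end

section \<open>Induced representations\<close>

locale induced_rep = group G for G (structure) +
  fixes K :: "'g set" and X :: "'a cspace" and \<theta> :: "'g \<Rightarrow> 'a \<Rightarrow> 'a"
  assumes K: "subgroup K G" and X: "pre_hilbert_space X"
    and \<theta>: "unitary_rep (G\<lparr>carrier := K\<rparr>) X \<theta>"
begin

interpretation X: pre_hilbert_space X
  by (rule X)

interpretation K: subgroup K G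
  by (rule K)

lemma theta_unitary: "k \<in> K \<Longrightarrow> unitary_map X X (\<theta> k)"
  using \<theta> by (simp add: unitary_rep_def)

lemma theta_closed: "\<lbrakk>k \<in> K; x \<in> carrier X\<rbrakk> \<Longrightarrow> \<theta> k x \<in> carrier X"
  using theta_unitary[of k] by (auto simp: unitary_map_def linear_map_def)

lemma theta_inner:
  "\<lbrakk>k \<in> K; x \<in> carrier X; y \<in> carrier X\<rbrakk> \<Longrightarrow> vinner X (\<theta> k x) (\<theta> k y) = vinner X x y"
  using theta_unitary[of k] by (auto simp: unitary_map_def)

lemma theta_mult: "\<lbrakk>k \<in> K; l \<in> K; x \<in> carrier X\<rbrakk> \<Longrightarrow> \<theta> (k \<otimes> l) x = \<theta> k (\<theta> l x)"
  using \<theta> by (simp add: unitary_rep_def)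

lemma theta_zero:
  assumes "k \<in> K"
  shows "\<theta> k (vzero X) = vzero X"
proof -
  have "\<theta> k (vscale X 0 (vzero X)) = vscale X 0 (\<theta> k (vzero X))"
    using theta_unitary[OF assms] X.zero_closed unfolding unitary_map_def linear_map_def by blast
  then show ?thesis
    using X.zero_closed theta_closed[OF assms X.zero_closed] by simp
qed

text \<open>\<open>unitary_rep\<close> does not state this; it follows because
  \<open>\<theta> \<one>\<close> is idempotent and injective.\<close>

lemma theta_one:
  assumes "x \<in> carrier X"
  shows "\<theta> \<one> x = x"
proof -
  have "\<theta> \<one> (\<theta> \<one> x) = \<theta> \<one> x"
    using theta_mult[of \<one> \<one> x] assms by simp
  moreover have "inj_on (\<theta> \<one>) (carrier X)"
    using theta_unitary[of \<one>] by (auto simp: unitary_map_def bij_betw_def)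
  ultimately show ?thesis
    using theta_closed[of \<one> x] assms by (auto dest: inj_onD)
qed

text \<open>The equivariant function supported on the coset \<open>gK\<close> with value
  \<open>x\<close> at \<open>g\<close>: at \<open>y = g k\<close> the element
  \<open>inv y \<otimes> g\<close> is \<open>inv k\<close>, as the equivariance in
  \<open>ind_space\<close> requires.\<close>

definition point_mass :: "'g \<Rightarrow> 'a \<Rightarrow> 'g \<Rightarrow> 'a" where
  "point_mass g x = (\<lambda>y\<in>carrier G. if inv g \<otimes> y \<in> K then \<theta> (inv y \<otimes> g) x else vzero X)"

lemma inv_mult_in_K:
  assumes "g \<in> carrier G" "y \<in> carrier G" "inv g \<otimes> y \<in> K"
  shows "inv y \<otimes> g \<in> K"
  using K.m_inv_closed[OF assms(3)] assms by (simp add: inv_mult_group)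

lemma coset_rep_mem:
  assumes "C \<in> lcosets K"
  shows "coset_rep C \<in> C" "coset_rep C \<in> carrier G" "C = coset_rep C <# K"
proof -
  obtain a where a: "a \<in> carrier G" "C = a <# K"
    using assms by (auto simp: LCOSETS_def)
  have "a \<in> C"
    using a lcos_self[OF _ K] by simp
  then show c: "coset_rep C \<in> C"
    unfolding coset_rep_def by (rule someI)
  then show "coset_rep C \<in> carrier G"
    using a l_coset_subset_G[OF K.subset] by blast
  show "C = coset_rep C <# K"
    using l_repr_independence[OF _ a(1) K] c a(2) by simp
qed

lemma coset_eqI:
  assumes "C \<in> lcosets K" "g \<in> carrier G" "inv g \<otimes> coset_rep C \<in> K"
  shows "C = g <# K"
proof -
  have "coset_rep C = g \<otimes> (inv g \<otimes> coset_rep C)"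
    using assms coset_rep_mem[OF assms(1)] by (simp add: m_assoc[symmetric])
  then have "coset_rep C \<in> g <# K"
    using assms(3) unfolding l_coset_def by blast
  then show ?thesis
    using l_repr_independence[OF _ assms(2) K] coset_rep_mem(3)[OF assms(1)] by simp
qed

lemma point_mass_closed:
  assumes "g \<in> carrier G" "x \<in> carrier X"
  shows "point_mass g x \<in> carrier (ind_space G K X \<theta>)"
proof -
  have "point_mass g x \<in> carrier G \<rightarrow>\<^sub>E carrier X"
    using assms by (auto simp: point_mass_def X.zero_closed intro!: theta_closed inv_mult_in_K)
  moreover have "point_mass g x (y \<otimes> k) = \<theta> (inv k) (point_mass g x y)"
    if "y \<in> carrier G" "k \<in> K" for y k
  proof -
    have k: "k \<in> carrier G"
      using that by simp
    have a: "inv g \<otimes> (y \<otimes> k) = (inv g \<otimes> y) \<otimes> k"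
      using that k assms by (simp add: m_assoc)
    have iff: "inv g \<otimes> (y \<otimes> k) \<in> K \<longleftrightarrow> inv g \<otimes> y \<in> K"
    proof
      assume "inv g \<otimes> (y \<otimes> k) \<in> K"
      then have "(inv g \<otimes> y) \<otimes> k \<otimes> inv k \<in> K"
        using a that by simp
      then show "inv g \<otimes> y \<in> K"
        using that k assms by (simp add: m_assoc)
    qed (use a that in simp)
    have "inv (y \<otimes> k) \<otimes> g = inv k \<otimes> (inv y \<otimes> g)"
      using that k assms by (simp add: inv_mult_group m_assoc)
    then show ?thesis
      using iff that k assms inv_mult_in_K[OF assms(1), of y]
      by (simp add: point_mass_def theta_mult theta_zero)
  qed
  moreover have "(\<lambda>C. (vnorm X (point_mass g x (coset_rep C)))\<^sup>2) summable_on (lcosets K)"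
  proof (rule summable_on_cong_neutral[THEN iffD1])
    show "(\<lambda>C. (vnorm X (point_mass g x (coset_rep C)))\<^sup>2) summable_on {g <# K}"
      by simp
    show "(vnorm X (point_mass g x (coset_rep C)))\<^sup>2 = 0" if "C \<in> lcosets K - {g <# K}" for C
      using that coset_eqI[of C g] coset_rep_mem[of C] assms by (auto simp: point_mass_def)
    show "(vnorm X (point_mass g x (coset_rep C)))\<^sup>2 = 0" if "C \<in> {g <# K} - lcosets K" for C
      using that assms by (auto simp: LCOSETS_def)
  qed auto
  ultimately show ?thesis
    by (simp add: ind_space_def)
qed

lemma ind_rep_point_mass:
  assumes "g \<in> carrier G" "h \<in> carrier G"
  shows "ind_rep G h (point_mass g x) = point_mass (h \<otimes> g) x"
  unfolding ind_rep_def point_mass_def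
  using assms by (intro restrict_ext) (simp add: inv_mult_group m_assoc)

text \<open>Together with \<open>ind_rep_point_mass\<close> this recovers \<open>\<theta>\<close>
  inside the induced representation: \<open>K\<close> acts by \<open>\<theta>\<close> on the
  functions supported on \<open>K\<close>.\<close>

lemma point_mass_K:
  assumes "k \<in> K" "x \<in> carrier X"
  shows "point_mass k x = point_mass \<one> (\<theta> k x)"
  unfolding point_mass_def
proof (rule restrict_ext)
  fix y assume y: "y \<in> carrier G"
  have k: "k \<in> carrier G"
    using assms by simp
  have iff: "inv k \<otimes> y \<in> K \<longleftrightarrow> y \<in> K"
  proof
    assume "inv k \<otimes> y \<in> K"
    then have "k \<otimes> (inv k \<otimes> y) \<in> K"
      using assms by simp
    then show "y \<in> K"
      using y k by (simp add: m_assoc[symmetric])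
  qed (use assms in simp)
  show "(if inv k \<otimes> y \<in> K then \<theta> (inv y \<otimes> k) x else vzero X)
      = (if inv \<one> \<otimes> y \<in> K then \<theta> (inv y \<otimes> \<one>) (\<theta> k x) else vzero X)"
    using iff y k assms by (simp add: theta_mult)
qed

lemma K_lcoset: "K \<in> lcosets K"
  using lcos_mult_one[OF K.subset] by (auto simp: LCOSETS_def intro!: bexI[of _ \<one>])

text \<open>Only the coset \<open>K\<close> contributes. Its chosen representative may be any
  element of \<open>K\<close>, and unitarity of \<open>\<theta>\<close> removes this choice.\<close>

lemma inner_point_mass:
  assumes "x \<in> carrier X" "y \<in> carrier X"
  shows "vinner (ind_space G K X \<theta>) (point_mass \<one> x) (point_mass \<one> y) = vinner X x y"
proof -
  let ?f = "\<lambda>C. vinner X (point_mass \<one> x (coset_rep C)) (point_mass \<one> y (coset_rep C))"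
  have "?f C = 0" if "C \<in> lcosets K" "C \<noteq> K" for C
    using coset_eqI[OF that(1), of \<one>] coset_rep_mem[OF that(1)] that lcos_mult_one[OF K.subset] X.zero_closed
    by (auto simp: point_mass_def)
  then have "infsum ?f (lcosets K) = ?f K"
    using K_lcoset infsum_cong_neutral[of "{K}" "lcosets K" ?f ?f] by simp
  also have "\<dots> = vinner X x y"
    using coset_rep_mem[OF K_lcoset] assms by (simp add: point_mass_def theta_inner)
  finally show ?thesis
    by (simp add: ind_space_def)
qed

text \<open>The two functions live on the cosets \<open>gK\<close> and \<open>K\<close>, which are
  disjoint for \<open>g\<close> outside \<open>K\<close>.\<close>

lemma inner_point_mass_disjoint:
  assumes "g \<in> carrier G" "g \<notin> K" "x \<in> carrier X" "y \<in> carrier X"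
  shows "vinner (ind_space G K X \<theta>) (point_mass g x) (point_mass \<one> y) = 0"
proof -
  have "vinner X (point_mass g x (coset_rep C)) (point_mass \<one> y (coset_rep C)) = 0" if C: "C \<in> lcosets K" for C
  proof -
    let ?c = "coset_rep C"
    have c: "?c \<in> carrier G"
      using coset_rep_mem[OF C] by simp
    have m: "point_mass g x ?c \<in> carrier X" "point_mass \<one> y ?c \<in> carrier X"
      using point_mass_closed[OF assms(1,3)] point_mass_closed[OF one_closed assms(4)] c
      by (auto simp: ind_space_def)
    show ?thesis
    proof (cases "inv g \<otimes> ?c \<in> K \<and> ?c \<in> K")
      case True
      then have "inv (inv g \<otimes> ?c \<otimes> inv ?c) \<in> K"
        by simp
      then have "g \<in> K"
        using c assms by (simp add: m_assoc)
      then show ?thesis using assms by simp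
    next
      case False
      then show ?thesis
        using m c by (auto simp: point_mass_def)
    qed
  qed
  then show ?thesis
    by (simp add: ind_space_def infsum_0)
qed

end

section \<open>Ind-mixing\<close>

theorem theoremC:
  fixes H :: "'h cspace" and A B :: "'h \<Rightarrow> 'h"
    and K :: "(tree \<times> tree) set set"
    and X :: "'k cspace" and \<theta> :: "(tree \<times> tree) set \<Rightarrow> 'k \<Rightarrow> 'k"
  assumes "hilbert_space H"
    and "pythagorean_pair H A B"
    and "diffuse H A B"
    and "subgroup K thompson_F"
    and "K \<noteq> {\<one>\<^bsub>thompson_F\<^esub>}"
    and "hilbert_space X"
    and "finite_dimensional X"
    and "carrier X \<noteq> {vzero X}"
    and "unitary_rep (thompson_F\<lparr>carrier := K\<rparr>) X \<theta>"
  shows "\<not> contained_in thompson_F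
           (ind_space thompson_F K X \<theta>) (ind_rep thompson_F)
           (pythagorean_space H A B) (pythagorean_rep H A B)"
proof
  assume "contained_in thompson_F (ind_space thompson_F K X \<theta>) (ind_rep thompson_F)
           (pythagorean_space H A B) (pythagorean_rep H A B)"
  then obtain M U where M: "M \<subseteq> carrier (pythagorean_space H A B)"
    and U: "unitary_map (ind_space thompson_F K X \<theta>) (pythagorean_space H A B\<lparr>carrier := M\<rparr>) U"
    and eq: "\<And>g \<phi>. \<lbrakk>g \<in> carrier thompson_F; \<phi> \<in> carrier (ind_space thompson_F K X \<theta>)\<rbrakk>
      \<Longrightarrow> U (ind_rep thompson_F g \<phi>) = pythagorean_rep H A B g (U \<phi>)"
    unfolding contained_in_def subrepresentation_def closed_csubspace_def csubspace_def unitarily_equivalent_def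
    by blast
  interpret diffuse_pair H A B
    using assms(1-3) by (auto simp: diffuse_pair_def diffuse_pair_axioms_def pythagorean_def
        pythagorean_axioms_def hilbert_space_def)
  interpret X: pre_hilbert_space X
    using assms(6) by (simp add: hilbert_space_def)
  interpret F: group thompson_F
    by (rule group_thompson)
  interpret ind: induced_rep thompson_F K X \<theta>
    by (intro induced_rep.intro induced_rep_axioms.intro group_thompson assms X.pre_hilbert_space_axioms)
  let ?I = "ind_space thompson_F K X \<theta>" and ?P = "pythagorean_space H A B"
  \<comment> \<open>The copy of the space of \<open>\<theta>\<close> inside \<open>\<sigma>\<close>.
    On it the coefficients of elements of \<open>K\<close> are those of \<open>\<theta>\<close>, and
    all other coefficients vanish.\<close>
  define p where "p x = U (ind.point_mass \<one>\<^bsub>thompson_F\<^esub> x)" for x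
  have U_inner: "vinner ?P (U \<phi>) (U \<psi>) = vinner ?I \<phi> \<psi>" if "\<phi> \<in> carrier ?I" "\<psi> \<in> carrier ?I" for \<phi> \<psi>
    using U that by (simp add: unitary_map_def)
  have p: "p x \<in> carrier ?P" if "x \<in> carrier X" for x
    using U M ind.point_mass_closed[OF F.one_closed that]
    by (auto simp: p_def unitary_map_def linear_map_def)
  have coeff: "vinner ?P (pythagorean_rep H A B g (p x)) (p y)
      = vinner ?I (ind.point_mass g x) (ind.point_mass \<one>\<^bsub>thompson_F\<^esub> y)"
    if "g \<in> carrier thompson_F" "x \<in> carrier X" "y \<in> carrier X" for g x y
  proof -
    have "pythagorean_rep H A B g (p x) = U (ind.point_mass g x)"
      using eq[OF that(1) ind.point_mass_closed[OF F.one_closed that(2)]] that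
      by (simp add: p_def ind.ind_rep_point_mass)
    then show ?thesis
      using that by (simp add: p_def U_inner ind.point_mass_closed)
  qed
  have coeff_K: "vinner ?P (pythagorean_rep H A B k (p x)) (p y) = vinner X (\<theta> k x) y"
    if "k \<in> K" "x \<in> carrier X" "y \<in> carrier X" for k x y
    using that subgroup.mem_carrier[OF assms(4)]
    by (simp add: coeff ind.point_mass_K ind.inner_point_mass ind.theta_closed)
  have coeff_not_K: "vinner ?P (pythagorean_rep H A B g (p x)) (p y) = 0"
    if "g \<in> carrier thompson_F" "g \<notin> K" "x \<in> carrier X" "y \<in> carrier X" for g x y
    using that by (simp add: coeff ind.inner_point_mass_disjoint)
  have "\<exists>s. vcauchy K_space s \<and> p x = cauchy_class K_space s" if "x \<in> carrier X" for x
    using p[OF that] by (auto simp: pythagorean_space_def completion_def)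
  then obtain S where S: "\<And>x. x \<in> carrier X \<Longrightarrow> vcauchy K_space (S x)"
      "\<And>x. x \<in> carrier X \<Longrightarrow> p x = cauchy_class K_space (S x)"
    by metis
  have approx: "\<forall>\<^sub>F n in sequentially. \<forall>g\<in>carrier thompson_F.
      cmod (vinner ?P (pythagorean_rep H A B g (p x)) (p y)
        - vinner K_space (dec_action H A B g (S x n)) (S y n)) \<le> e"
    if "x \<in> carrier X" "y \<in> carrier X" "e > 0" for x y e
  proof -
    have "\<forall>\<^sub>F n in sequentially. \<forall>T\<in>dec_action H A B ` carrier thompson_F.
        cmod (vinner (completion K_space) (completion_map K_space T (cauchy_class K_space (S x)))
          (cauchy_class K_space (S y)) - vinner K_space (T (S x n)) (S y n)) \<le> e"
    proof (rule Ks.completion_coefficient_approx[OF S(1)[OF that(1)] S(1)[OF that(2)] that(3)])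
      fix T z z' assume T: "T \<in> dec_action H A B ` carrier thompson_F" and z: "z \<in> carrier K_space"
      show "T z \<in> carrier K_space" "vnorm K_space (T z) = vnorm K_space z"
        using T dec_action_isometry(1,2)[OF _ z z] by auto
      show "vdist K_space (T z) (T z') = vdist K_space z z'" if "z' \<in> carrier K_space"
        using T dec_action_isometry(3)[OF _ z that] by auto
    qed
    then show ?thesis
      using that by (simp add: S(2) pythagorean_space_def pythagorean_rep_def)
  qed
  obtain es where es: "set es \<subseteq> carrier X" "\<And>x. x \<in> carrier X \<Longrightarrow> X.bessel_sum es x = x"
    using X.finite_dimensional_bessel[OF assms(7)] by blast
  obtain x where x: "x \<in> carrier X" "x \<noteq> vzero X"
    using assms(8) X.zero_closed by blast
  define c where "c = (vnorm X x)\<^sup>2"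
  have c: "c > 0"
    using x X.norm_eq_0[of x] by (simp add: c_def)
  \<comment> \<open>The bound \<open>c / 4\<close> keeps the squared norm of the approximating
    vector above \<open>e\<close>, as it is at least \<open>c - e\<close>. The other bound keeps a
    sum of \<open>length es\<close> squares of \<open>2 * e\<close> below \<open>c\<close>; the
    added 1 makes this strict and covers an empty list.\<close>
  define e where "e = min (c / 4) (sqrt (c / (4 * (length es + 1))))"
  have e: "e > 0" "e \<le> c / 4"
    using c by (simp_all add: e_def)
  have "e\<^sup>2 \<le> (sqrt (c / (4 * (length es + 1))))\<^sup>2"
    using e(1) by (intro power_mono) (auto simp: e_def)
  then have "4 * e\<^sup>2 + length es * (2 * e)\<^sup>2 \<le> c"
    using c by (simp add: field_simps)
  moreover have "e\<^sup>2 > 0"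
    using e(1) by simp
  ultimately have e2: "length es * (2 * e)\<^sup>2 < c"
    by linarith
  \<comment> \<open>One index serves \<open>x\<close>, for the test of membership in
    \<open>K\<close>, and all of \<open>es\<close>, for Parseval's identity.\<close>
  have "\<forall>\<^sub>F n in sequentially. \<forall>y\<in>insert x (set es). \<forall>g\<in>carrier thompson_F.
      cmod (vinner ?P (pythagorean_rep H A B g (p x)) (p y)
        - vinner K_space (dec_action H A B g (S x n)) (S y n)) \<le> e"
    using approx x(1) es(1) e(1) by (intro eventually_ball_finite) auto
  from eventually_happens'[OF sequentially_bot this]
  obtain n where n: "\<And>y g. \<lbrakk>y \<in> insert x (set es); g \<in> carrier thompson_F\<rbrakk> \<Longrightarrow>
      cmod (vinner ?P (pythagorean_rep H A B g (p x)) (p y)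
        - vinner K_space (dec_action H A B g (S x n)) (S y n)) \<le> e"
    by blast
  define v where "v = S x n"
  have Sn: "S y n \<in> carrier K_space" if "y \<in> carrier X" for y
    using S(1)[OF that] Ks.cauchy_carrier by blast
  have v: "v \<in> carrier K_space"
    using Sn x by (simp add: v_def)
  have one: "dec_action H A B \<one>\<^bsub>thompson_F\<^esub> v = v"
  proof -
    obtain t \<xi> where "\<xi> \<in> decorations H t" "v = dc t \<xi>"
      using v by (auto simp: carrier_K_space)
    then show ?thesis
      by (simp add: one_thompson[of t] dec_action_class)
  qed
  \<comment> \<open>The coefficient estimate at the identity element, which compares the squared
    norms of \<open>x\<close> and \<open>v\<close>.\<close>
  have "cmod (vinner X x x - vinner K_space v v) \<le> e"
    using n[of x "\<one>\<^bsub>thompson_F\<^esub>"] coeff_K[OF subgroup.one_closed[OF assms(4)] x(1) x(1)] ind.theta_one[OF x(1)] one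
    by (simp add: v_def)
  then have "\<bar>c - (vnorm K_space v)\<^sup>2\<bar> \<le> e"
    unfolding X.inner_self[OF x(1)] Ks.inner_self[OF v] of_real_diff[symmetric] norm_of_real by (simp add: c_def)
  then have gap: "e < (vnorm K_space v)\<^sup>2"
    using e c by linarith
  \<comment> \<open>Outside \<open>K\<close> the exact coefficient is zero, so the approximating one
    is bounded by the error \<open>e\<close>, which serves as the threshold
    \<open>d\<close>.\<close>
  have big: "Re (vinner K_space (dec_action H A B g v) v) \<le> e" if "g \<in> carrier thompson_F" "g \<notin> K" for g
    using n[of x g] that coeff_not_K[OF that x(1,1)]
      complex_Re_le_cmod[of "vinner K_space (dec_action H A B g v) v"] by (simp add: v_def)
  obtain h where h: "h \<in> K" "\<forall>w\<in>(\<lambda>y. S y n) ` set es. cmod (vinner K_space (dec_action H A B h v) w) < e"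
    using exists_small_coefficients[OF assms(4) _ _ v e(1) gap big, of "(\<lambda>y. S y n) ` set es"] Sn es(1)
    by blast
  \<comment> \<open>One \<open>e\<close> is the error of approximation, the other the bound obtained
    from the choice of \<open>h\<close>.\<close>
  have small: "(cmod (vinner X (\<theta> h x) y))\<^sup>2 \<le> (2 * e)\<^sup>2" if "y \<in> set es" for y
  proof -
    have "cmod (vinner X (\<theta> h x) y - vinner K_space (dec_action H A B h v) (S y n)) \<le> e"
      using n[of y h] that h(1) coeff_K[OF h(1) x(1), of y] es(1) subgroup.mem_carrier[OF assms(4) h(1)]
      by (auto simp: v_def)
    moreover have "cmod (vinner K_space (dec_action H A B h v) (S y n)) < e"
      using h(2) that by blast
    ultimately have "cmod (vinner X (\<theta> h x) y) \<le> 2 * e"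
      using norm_triangle_sub[of "vinner X (\<theta> h x) y" "vinner K_space (dec_action H A B h v) (S y n)"]
      by linarith
    then show ?thesis
      by (intro power_mono) auto
  qed
  have hx: "\<theta> h x \<in> carrier X"
    using ind.theta_closed h(1) x(1) by blast
  \<comment> \<open>The unitary \<open>\<theta> h\<close> preserves the norm of \<open>x\<close>,
    yet by Parseval's identity its image would have squared norm below \<open>c\<close>.\<close>
  have "c = (vnorm X (\<theta> h x))\<^sup>2"
    using ind.theta_inner[OF h(1) x(1,1)] by (simp add: c_def vnorm_def)
  also have "\<dots> = (\<Sum>y\<leftarrow>es. (cmod (vinner X (\<theta> h x) y))\<^sup>2)"
    using X.parseval[OF es(1) hx] es(2) hx by blast
  also have "\<dots> \<le> (\<Sum>y\<leftarrow>es. (2 * e)\<^sup>2)"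
    using small by (rule sum_list_mono)
  also have "\<dots> = length es * (2 * e)\<^sup>2"
    by (simp add: sum_list_triv)
  finally show False
    using e2 by simp
qed

end
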